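(* Let $\Gamma$ be a free abelian group of finite rank and let $\mathfrak g=\bigoplus_{\gamma\in\Gamma}\mathfrak g_\gamma$ be a $\Gamma$-graded Lie algebra over a commutative $\mathbb Q$-algebra. Let $M$ be a path-connected topological space and let $(Z,a)=(Z_x,a_x)_{x\in M}$ be a continuous family of stability data on $M$ (with values in $\mathfrak g$). Let $Q:\Gamma_{\mathbb R}\to\mathbb R$ be a quadratic form that is negative semi-definite on $\operatorname{Ker}(Z_x:\Gamma_{\mathbb R}\to\mathbb C)$ for all $x\in M$. If there exists $x\in M$ such that $\operatorname{supp}a_x\subset\{Q\ge0\}$, then $\operatorname{supp}a_y\subset\{Q\ge0\}$ for all $y\in M$.
   Context: $\Gamma_{\mathbb R}=\Gamma\otimes\mathbb R$ carries a norm $\|\cdot\|$. Put $\hat{\mathfrak g}=\prod_{\gamma\in\Gamma\setminus\{0\}}\mathfrak g_\gamma$ (a vector space), and for $a\in\hat{\mathfrak g}$ put $\operatorname{supp}(a)=\{\gamma:a_\gamma\ne0\}$. Cones: a cone $V\subset\mathbb C$ is a subset with $\mathbb R_{>0}V\subset V$; it is blunt if $0\notin V$. A convex cone is strict if its closure contains no line. A ray is $\mathbb R_{>0}z$, $z\neq0$. For a blunt strict convex cone $V\subset\mathbb C$, a linear map $Z:\Gamma\to\mathbb C$ and $\varepsilon>0$, let $S(V,Z,\varepsilon)\subset\Gamma$ be the semigroup (all finite sums with at least one summand) generated by $\{\gamma\in\Gamma: Z(\gamma)\in V,\ |Z(\gamma)|\ge\varepsilon\|\gamma\|\}$; the convex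 cone it generates in $\Gamma_{\mathbb R}$ is strict and every element has finitely many decompositions as a sum of elements of the semigroup. Hence $\hat{\mathfrak g}_{V,Z,\varepsilon}=\prod_{\gamma\in S(V,Z,\varepsilon)}\mathfrak g_\gamma$ is a pro-nilpotent Lie algebra (the inverse limit of the nilpotent Lie algebras $\bigoplus_{\gamma\in J}\mathfrak g_\gamma$ over finite subsets $J\subset S(V,Z,\varepsilon)$ that are lower sets for the order $\alpha\le\beta\iff\beta-\alpha\in S(V,Z,\varepsilon)\cup\{0\}$), with pro-nilpotent group $\hat G_{V,Z,\varepsilon}$ and bijection $\exp:\hat{\mathfrak g}_{V,Z,\varepsilon}\to\hat G_{V,Z,\varepsilon}$. Put $\hat{\mathfrak g}_{V,Z}=\bigcup_{\varepsilon>0}\hat{\mathfrak g}_{V,Z,\varepsilon}\subset\hat{\mathfrak g}$ and $\hat G_{V,Z}=\varinjlim_{\varepsilon}\hat G_{V,Z,\varepsilon}$, with bijection $\exp:\hat{\mathfrak g}_{V,Z}\to\hat G_{V,Z}$ and inverse $\log$. Stability data is a pair $(Z,a)$ with $Z\in\operatorname{Hom}(\Gamma,\mathbb C)$ and $a\in\hat{\mathfrak g}$ such that $\operatorname{supp}(a)\subset\{\gamma:|Z(\gamma)|\ge\varepsilon\|\gamma\|\}$ for some $\varepsilon>0$. For a blunt strict cone $V$, define $A_V=\prod^{\to}_{\ell\subset V}\exp(a_\ell)\in\hat G_{V,Z}$, where $a_\ell=\sum_{Z(\gamma)\in\ell}a_\gamma$ and the product runs over rays $\ell\subset V$ in clockwise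 order. A continuous family of stability data on $M$ is a continuous map $Z:M\to\operatorname{Hom}(\Gamma,\mathbb C)$, $x\mapsto Z_x$, together with $a=(a_x\in\hat{\mathfrak g})_{x\in M}$ such that (1) for any $x\in M$ there are an open neighborhood $U$ of $x$ and $\varepsilon>0$ with $\operatorname{supp}(a_y)\subset\{\gamma\in\Gamma:|Z_y(\gamma)|\ge\varepsilon\|\gamma\|\}$ for all $y\in U$; (2) for any $x\in M$, any blunt strict cone $V\subset\mathbb C$ with $Z_x(\operatorname{supp}a_x)\cap\partial V=\emptyset$ and any $\gamma\in\Gamma$, the map $y\mapsto p_\gamma\log(A_{y,V})\in\mathfrak g_\gamma$ is constant in a neighborhood of $x$, where $A_{y,V}\in\hat G_{V,Z_y}$ is the element $A_V$ associated with $(Z_y,a_y)$ and $p_\gamma:\hat{\mathfrak g}\to\mathfrak g_\gamma$ is the projection. *)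

theory Defs
  imports "HOL-Analysis.Analysis"
begin

section \<open>Free abelian groups of finite rank and extension of scalars to the reals\<close>

text \<open>An abelian group is a type of class \<^class>\<open>ab_group_add\<close>; \<open>zmul\<close> is its canonical
  structure of a module over the integers.\<close>

definition zmul :: "int \<Rightarrow> 'g::ab_group_add \<Rightarrow> 'g" where
  "zmul n x = (\<Sum>_<nat n. x) - (\<Sum>_<nat (- n). x)"

lemma zmul_diff: "zmul (int a - int b) x = (\<Sum>_<a. x) - (\<Sum>_<b. x)"
proof -
  have split: "(\<Sum>_<m + d. x) = (\<Sum>_<m. x) + (\<Sum>_<d. x)" for m d :: nat
    by (induction d) (simp_all add: algebra_simps)
  show ?thesis
  proof (cases "b \<le> a")
    case True
    then obtain d where "a = b + d" using le_Suc_ex by blast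
    then show ?thesis by (simp add: zmul_def split)
  next
    case False
    then obtain d where "b = a + d" using le_Suc_ex nat_le_linear by blast
    then show ?thesis by (simp add: zmul_def split)
  qed
qed

interpretation int_module: module "zmul :: int \<Rightarrow> 'g::ab_group_add \<Rightarrow> 'g"
proof
  have nsum_add: "(\<Sum>_<m + d. z) = (\<Sum>_<m. z) + (\<Sum>_<d. z)" for m d :: nat and z :: 'g
    by (induction d) (simp_all add: algebra_simps)
  have nsum_mult: "(\<Sum>_<m * d. z) = (\<Sum>_<m. \<Sum>_<d. z)" for m d :: nat and z :: 'g
    by (induction m) (simp_all add: nsum_add algebra_simps)
  fix a b :: int and x y :: 'g
  obtain k l where a: "a = int k - int l" by (rule int_diff_cases)
  obtain m n where b: "b = int m - int n" by (rule int_diff_cases)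
  show "zmul a (x + y) = zmul a x + zmul a y"
    by (simp add: zmul_def sum.distrib)
  have "zmul (a + b) x = zmul (int (k + m) - int (l + n)) x"
    by (rule arg_cong[where f = "\<lambda>c. zmul c x"]) (simp add: a b)
  also have "\<dots> = zmul a x + zmul b x"
    unfolding a b zmul_diff nsum_add by simp
  finally show "zmul (a + b) x = zmul a x + zmul b x" .
  have "zmul (a * b) x = zmul (int (k * m + l * n) - int (k * n + l * m)) x"
    by (rule arg_cong[where f = "\<lambda>c. zmul c x"]) (simp add: a b algebra_simps)
  also have "\<dots> = zmul a (zmul b x)"
    unfolding a b zmul_diff nsum_add nsum_mult by (simp add: sum_subtractf)
  finally show "zmul a (zmul b x) = zmul (a * b) x" by simp
  show "zmul 1 x = x" by (simp add: zmul_def)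
qed

text \<open>\<open>\<Gamma>\<close> is the type \<open>'g\<close> and \<open>\<Gamma>\<^sub>\<real> = \<Gamma> \<otimes> \<real>\<close> is the type \<open>'v\<close>, with \<open>\<iota> \<gamma> = \<gamma> \<otimes> 1\<close>: some finite
  integral basis of \<open>\<Gamma>\<close> is mapped injectively to a real basis of \<open>\<Gamma>\<^sub>\<real>\<close>, which determines \<open>(\<Gamma>\<^sub>\<real>, \<iota>)\<close>
  up to unique isomorphism. Rank 0 is included. The norm on \<open>\<Gamma>\<^sub>\<real>\<close> is the norm of the type \<open>'v\<close>,
  hence arbitrary.\<close>

locale real_scalar_extension = additive \<iota>
  for \<iota> :: "'g::ab_group_add \<Rightarrow> 'v::real_normed_vector" +
  assumes ex_basis: "\<exists>B. finite B \<and> int_module.independent B \<and> int_module.span B = UNIV \<and>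
    inj_on \<iota> B \<and> independent (\<iota> ` B) \<and> span (\<iota> ` B) = UNIV"

text \<open>The linear extension \<open>\<Gamma>\<^sub>\<real> \<rightarrow> \<complex>\<close> of an additive map \<open>\<Gamma> \<rightarrow> \<complex>\<close>.\<close>

definition real_extension ::
    "('g::ab_group_add \<Rightarrow> 'v::real_normed_vector) \<Rightarrow> ('g \<Rightarrow> complex) \<Rightarrow> 'v \<Rightarrow> complex" where
  "real_extension \<iota> Z = (THE F. linear F \<and> (\<forall>\<gamma>. F (\<iota> \<gamma>) = Z \<gamma>))"

definition quadratic_form :: "('v::real_vector \<Rightarrow> real) \<Rightarrow> bool" where
  "quadratic_form Q \<longleftrightarrow>
    (\<exists>B. bilinear B \<and> (\<forall>u v. B u v = B v u) \<and> (\<forall>v. Q v = B v v))"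


section \<open>Cones in the plane\<close>

text \<open>The library's \<^const>\<open>cone\<close> is closed under multiplication by 0; here only positive scalars
  are allowed.\<close>

definition blunt_strict_cone :: "complex set \<Rightarrow> bool" where
  "blunt_strict_cone V \<longleftrightarrow>
    (\<forall>z\<in>V. \<forall>t>0. t *\<^sub>R z \<in> V) \<and> 0 \<notin> V \<and> convex V \<and>
    \<not> (\<exists>p v. v \<noteq> 0 \<and> range (\<lambda>t. p + t *\<^sub>R v) \<subseteq> closure V)"

definition is_ray :: "complex set \<Rightarrow> bool" where
  "is_ray l \<longleftrightarrow> (\<exists>z. z \<noteq> 0 \<and> l = {t *\<^sub>R z |t. t > 0})"

text \<open>For rays in a common strict cone, \<open>l\<close> precedes \<open>l'\<close> in clockwise order iff the angle from
  \<open>l'\<close> counterclockwise to \<open>l\<close> lies in \<open>(0, \<pi>)\<close>.\<close>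

definition clockwise :: "complex set \<Rightarrow> complex set \<Rightarrow> bool" where
  "clockwise l l' \<longleftrightarrow> (\<exists>z\<in>l. \<exists>w\<in>l'. Im (z * cnj w) > 0)"

definition clockwise_list :: "complex set set \<Rightarrow> complex set list" where
  "clockwise_list R = (THE ls. set ls = R \<and> sorted_wrt clockwise ls)"


section \<open>Graded Lie algebras and their completions\<close>

text \<open>Elements of products of the spaces \<open>\<gg>\<^sub>\<gamma>\<close> are functions \<open>a\<close> on \<open>\<Gamma>\<close> with \<open>a \<gamma> \<in> \<gg>\<^sub>\<gamma>\<close>.\<close>

definition supp :: "('g \<Rightarrow> 'a::zero) \<Rightarrow> 'g set" where
  "supp a = {\<gamma>. a \<gamma> \<noteq> 0}"

text \<open>The pro-nilpotent group of a pro-nilpotent Lie algebra over the rationals consists of formal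
  exponentials, multiplied by the Baker-Campbell-Hausdorff formula. \<open>Exp\<close> and \<open>Log\<close> are the
  mutually inverse bijections between the Lie algebra and the group.\<close>

datatype 'x formal_exp = Exp (Log: 'x)

text \<open>Dynkin's form of the Baker-Campbell-Hausdorff series \<open>log (e\<^sup>x e\<^sup>y)\<close>: the sum over nonempty
  lists \<open>(r\<^sub>1,s\<^sub>1), \<dots>, (r\<^sub>n,s\<^sub>n)\<close> with all \<open>r\<^sub>i + s\<^sub>i > 0\<close> of the right-nested bracket of
  \<open>x\<^bsup>r\<^sub>1\<^esup> y\<^bsup>s\<^sub>1\<^esup> \<dots> x\<^bsup>r\<^sub>n\<^esup> y\<^bsup>s\<^sub>n\<^esup>\<close> with coefficient
  \<open>(-1)\<^bsup>n-1\<^esup> / (n \<cdot> \<Sum>(r\<^sub>i + s\<^sub>i) \<cdot> \<Prod>(r\<^sub>i! s\<^sub>i!))\<close>.\<close>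

definition dynkin_index :: "(nat \<times> nat) list set" where
  "dynkin_index = {ps. ps \<noteq> [] \<and> (\<forall>(r, s)\<in>set ps. r + s > 0)}"

definition dynkin_coeff :: "(nat \<times> nat) list \<Rightarrow> rat" where
  "dynkin_coeff ps = (- 1) ^ (length ps - 1) /
    (of_nat (length ps) * of_nat (\<Sum>(r, s)\<leftarrow>ps. r + s) * (\<Prod>(r, s)\<leftarrow>ps. fact r * fact s))"

definition dynkin_word :: "'x \<Rightarrow> 'x \<Rightarrow> (nat \<times> nat) list \<Rightarrow> 'x list" where
  "dynkin_word x y ps = concat (map (\<lambda>(r, s). replicate r x @ replicate s y) ps)"

text \<open>The Lie algebra \<open>\<gg>\<close> is the whole type \<open>'a\<close>, over the commutative ring \<open>'k\<close>, which is a
  rational algebra via \<open>\<phi>\<close>; \<open>G \<gamma>\<close> is the graded piece \<open>\<gg>\<^sub>\<gamma>\<close>.\<close>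

locale graded_lie_algebra =
  real_scalar_extension \<iota> + module scale
  for \<iota> :: "'g::ab_group_add \<Rightarrow> 'v::real_normed_vector"
    and scale :: "'k::comm_ring_1 \<Rightarrow> 'a::ab_group_add \<Rightarrow> 'a" +
  fixes \<phi> :: "rat \<Rightarrow> 'k"
    and br :: "'a \<Rightarrow> 'a \<Rightarrow> 'a"
    and G :: "'g \<Rightarrow> 'a set"
  assumes rat_one: "\<phi> 1 = 1"
    and rat_add: "\<phi> (p + q) = \<phi> p + \<phi> q"
    and rat_mult: "\<phi> (p * q) = \<phi> p * \<phi> q"
    and br_linear_right: "module_hom scale scale (\<lambda>v. br u v)"
    and br_linear_left: "module_hom scale scale (\<lambda>u. br u v)"
    and br_alternating: "br u u = 0"
    and jacobi: "br u (br v w) + br v (br w u) + br w (br u v) = 0"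
    and graded_subspace: "subspace (G \<gamma>)"
    and direct_sum: "\<exists>!f. finite (supp f) \<and> (\<forall>\<gamma>. f \<gamma> \<in> G \<gamma>) \<and> u = (\<Sum>\<gamma>\<in>supp f. f \<gamma>)"
    and br_graded: "u \<in> G \<alpha> \<Longrightarrow> v \<in> G \<beta> \<Longrightarrow> br u v \<in> G (\<alpha> + \<beta>)"
begin

text \<open>The product of the spaces \<open>\<gg>\<^sub>\<gamma>\<close> over \<open>\<gamma> \<noteq> 0\<close>.\<close>

definition ghat :: "('g \<Rightarrow> 'a) set" where
  "ghat = {a. (\<forall>\<gamma>. a \<gamma> \<in> G \<gamma>) \<and> a 0 = 0}"

definition semigroup_S :: "complex set \<Rightarrow> ('g \<Rightarrow> complex) \<Rightarrow> real \<Rightarrow> 'g set" where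
  "semigroup_S V Z \<epsilon> = {sum_list \<gamma>s |\<gamma>s.
    \<gamma>s \<noteq> [] \<and> set \<gamma>s \<subseteq> {\<gamma>. Z \<gamma> \<in> V \<and> cmod (Z \<gamma>) \<ge> \<epsilon> * norm (\<iota> \<gamma>)}}"

definition ghat_eps :: "complex set \<Rightarrow> ('g \<Rightarrow> complex) \<Rightarrow> real \<Rightarrow> ('g \<Rightarrow> 'a) set" where
  "ghat_eps V Z \<epsilon> = {a \<in> ghat. supp a \<subseteq> semigroup_S V Z \<epsilon>}"

definition ghat_cone :: "complex set \<Rightarrow> ('g \<Rightarrow> complex) \<Rightarrow> ('g \<Rightarrow> 'a) set" where
  "ghat_cone V Z = (\<Union>\<epsilon>\<in>{0<..}. ghat_eps V Z \<epsilon>)"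

text \<open>For \<open>a\<close>, \<open>b\<close> in one of the algebras \<^term>\<open>ghat_eps V Z \<epsilon>\<close> with \<open>V\<close> a blunt strict cone and
  \<open>\<epsilon> > 0\<close>, each degree has only finitely many decompositions into elements of the semigroup. So
  the sums in \<open>hbr\<close> and \<open>bch\<close> are finite, and they compute bracket and product of the inverse
  limit of nilpotent quotients degree by degree. Neither depends on \<open>\<epsilon>\<close>.\<close>

definition hbr :: "('g \<Rightarrow> 'a) \<Rightarrow> ('g \<Rightarrow> 'a) \<Rightarrow> 'g \<Rightarrow> 'a" where
  "hbr a b = (\<lambda>\<gamma>. \<Sum>\<alpha> | a \<alpha> \<noteq> 0 \<and> b (\<gamma> - \<alpha>) \<noteq> 0. br (a \<alpha>) (b (\<gamma> - \<alpha>)))"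

fun nested_hbr :: "('g \<Rightarrow> 'a) list \<Rightarrow> 'g \<Rightarrow> 'a" where
  "nested_hbr [] = (\<lambda>_. 0)"
| "nested_hbr [a] = a"
| "nested_hbr (a # b # as) = hbr a (nested_hbr (b # as))"

definition bch :: "('g \<Rightarrow> 'a) \<Rightarrow> ('g \<Rightarrow> 'a) \<Rightarrow> 'g \<Rightarrow> 'a" where
  "bch a b = (\<lambda>\<gamma>.
    \<Sum>ps | ps \<in> dynkin_index \<and> nested_hbr (dynkin_word a b ps) \<gamma> \<noteq> 0.
      scale (\<phi> (dynkin_coeff ps)) (nested_hbr (dynkin_word a b ps) \<gamma>))"

definition Ghat_cone :: "complex set \<Rightarrow> ('g \<Rightarrow> complex) \<Rightarrow> ('g \<Rightarrow> 'a) formal_exp set" where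
  "Ghat_cone V Z = Exp ` ghat_cone V Z"

definition Ghat_mult ::
    "('g \<Rightarrow> 'a) formal_exp \<Rightarrow> ('g \<Rightarrow> 'a) formal_exp \<Rightarrow> ('g \<Rightarrow> 'a) formal_exp" where
  "Ghat_mult g h = Exp (bch (Log g) (Log h))"

definition Ghat_one :: "('g \<Rightarrow> 'a) formal_exp" where
  "Ghat_one = Exp (\<lambda>_. 0)"


section \<open>Stability data\<close>

definition stability_data :: "('g \<Rightarrow> complex) \<Rightarrow> ('g \<Rightarrow> 'a) \<Rightarrow> bool" where
  "stability_data Z a \<longleftrightarrow> Modules.additive Z \<and> a \<in> ghat \<and>
    (\<exists>\<epsilon>>0. supp a \<subseteq> {\<gamma>. cmod (Z \<gamma>) \<ge> \<epsilon> * norm (\<iota> \<gamma>)})"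

definition ray_part :: "('g \<Rightarrow> complex) \<Rightarrow> ('g \<Rightarrow> 'a) \<Rightarrow> complex set \<Rightarrow> 'g \<Rightarrow> 'a" where
  "ray_part Z a l = (\<lambda>\<gamma>. if Z \<gamma> \<in> l then a \<gamma> else 0)"

text \<open>The product of \<open>Exp a\<^sub>l\<close> over a finite set \<open>R\<close> of rays \<open>l\<close>, clockwise from left to right.\<close>

definition ordered_product ::
    "('g \<Rightarrow> complex) \<Rightarrow> ('g \<Rightarrow> 'a) \<Rightarrow> complex set set \<Rightarrow> ('g \<Rightarrow> 'a) formal_exp" where
  "ordered_product Z a R =
    foldr Ghat_mult (map (\<lambda>l. Exp (ray_part Z a l)) (clockwise_list R)) Ghat_one"

text \<open>The product over all rays in \<open>V\<close> is the limit of the finite ordered products in the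
  pro-nilpotent group: every homogeneous component is eventually constant.\<close>

definition A_cone ::
    "('g \<Rightarrow> complex) \<Rightarrow> ('g \<Rightarrow> 'a) \<Rightarrow> complex set \<Rightarrow> ('g \<Rightarrow> 'a) formal_exp" where
  "A_cone Z a V = (THE g. g \<in> Ghat_cone V Z \<and>
    (\<forall>\<gamma>. \<forall>\<^sub>F R in finite_subsets_at_top {l. is_ray l \<and> l \<subseteq> V}.
      Log (ordered_product Z a R) \<gamma> = Log g \<gamma>))"

text \<open>\<open>Hom(\<Gamma>, \<complex>)\<close> is a finite-dimensional complex vector space; its topology is that of pointwise
  convergence, i.e. the subspace topology of the product topology on \<open>'g \<Rightarrow> complex\<close>.\<close>

definition continuous_stability_family ::
    "'m topology \<Rightarrow> ('m \<Rightarrow> 'g \<Rightarrow> complex) \<Rightarrow> ('m \<Rightarrow> 'g \<Rightarrow> 'a) \<Rightarrow> bool" where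
  "continuous_stability_family M Z a \<longleftrightarrow>
    continuous_map M (subtopology euclidean {f. Modules.additive f}) Z \<and>
    (\<forall>x\<in>topspace M. stability_data (Z x) (a x)) \<and>
    (\<forall>x\<in>topspace M. \<exists>U \<epsilon>. openin M U \<and> x \<in> U \<and> \<epsilon> > 0 \<and>
      (\<forall>y\<in>U. supp (a y) \<subseteq> {\<gamma>. cmod (Z y \<gamma>) \<ge> \<epsilon> * norm (\<iota> \<gamma>)})) \<and>
    (\<forall>x\<in>topspace M. \<forall>V. blunt_strict_cone V \<longrightarrow> Z x ` supp (a x) \<inter> frontier V = {} \<longrightarrow>
      (\<forall>\<gamma>. \<exists>U. openin M U \<and> x \<in> U \<and>
        (\<lambda>y. Log (A_cone (Z y) (a y) V) \<gamma>) constant_on U))"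

end

end

theory Submission
  imports Defs
begin

text \<open>
  Along a path, consider a short parameter interval on which the central charge \<open>Z\<close> is close to its
  value \<open>Z\<^sub>s\<close> at a reference point \<open>s\<close>, relative to the constant in the support condition. A component
  \<open>a \<gamma>\<close> with \<open>Q \<gamma> < 0\<close> is locally constant there, by induction on \<open>\<bar>Z\<^sub>s \<gamma>\<bar>\<close>. Near any point
  \<open>x\<close> of the interval, take a sector around \<open>Z\<^sub>x \<gamma>\<close> so thin that it excludes the finitely many relevant
  charges not on that ray. In degree \<open>\<gamma>\<close> the logarithm of the ordered product over this sector is constant,
  and it equals \<open>a \<gamma>\<close> unless \<open>\<gamma>\<close> is a sum of at least two elements \<open>\<beta>\<close> of the support with \<open>Z\<^sub>x \<beta>\<close> on the ray.
  Semi-definiteness on the kernel makes \<open>{Q \<ge> 0}\<close> convex over a ray, so some summand has \<open>Q \<beta> < 0\<close>; and as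
  the values of \<open>Z\<^sub>s\<close> on the summands lie in an open sector with a right angle,
  \<open>\<bar>Z\<^sub>s \<beta>\<bar> < \<bar>Z\<^sub>s \<gamma>\<bar>\<close>. The inductive hypothesis excludes such a \<open>\<beta>\<close>. Measuring with the fixed \<open>Z\<^sub>s\<close> and not
  with the moving \<open>Z\<close> is what makes the induction well-founded.
\<close>

section \<open>Lattices in a finite-dimensional normed space\<close>

text \<open>By homogeneity only coordinates of l1 norm 1 matter. They form a compact set on which
  the continuous function \<open>F\<close> is positive by independence; the reciprocal of its
  minimum serves as \<open>C\<close>.\<close>

lemma coordinate_bound:
  fixes e :: "'i \<Rightarrow> 'v::real_normed_vector"
  assumes "finite B" and "inj_on e B" and "independent (e ` B)"
  obtains C where "C > 0" and "\<And>x. (\<Sum>b\<in>B. \<bar>x b\<bar>) \<le> C * norm (\<Sum>b\<in>B. x b *\<^sub>R e b)"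
proof (cases "B = {}")
  case True
  then show ?thesis using that[of 1] by simp
next
  case False
  define F where "F = (\<lambda>x. norm (\<Sum>b\<in>B. x b *\<^sub>R e b))"
  \<comment> \<open>Coordinates outside \<open>B\<close> are pinned to 0, so that \<open>P\<close>
    is a product of compact sets over the whole index type.\<close>
  define P where "P = (\<Pi>\<^sub>E i\<in>UNIV. if i \<in> B then {-1..1} else {0::real})"
  define K where "K = P \<inter> {x. (\<Sum>b\<in>B. \<bar>x b\<bar>) = 1}"
  have "compactin (product_topology (\<lambda>_. euclidean) UNIV) P"
    unfolding P_def compactin_PiE by simp
  then have "compact P" by (simp add: euclidean_product_topology)
  moreover have "closed {x. (\<Sum>b\<in>B. \<bar>x b\<bar>) = (1::real)}"
    by (intro closed_Collect_eq continuous_intros continuous_on_product_coordinates)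
  ultimately have K: "compact K" unfolding K_def by (rule compact_Int_closed)
  have "continuous_on K F"
    unfolding F_def
    by (intro continuous_intros continuous_on_subset[OF continuous_on_product_coordinates]) auto
  have norm1: "(\<lambda>i. if i \<in> B then x i / (\<Sum>b\<in>B. \<bar>x b\<bar>) else 0) \<in> K"
    if "(\<Sum>b\<in>B. \<bar>x b\<bar>) \<noteq> 0" for x :: "'i \<Rightarrow> real"
  proof -
    have "\<bar>x i\<bar> \<le> (\<Sum>b\<in>B. \<bar>x b\<bar>)" if "i \<in> B" for i
      using that \<open>finite B\<close> by (intro member_le_sum) auto
    moreover have "(\<Sum>b\<in>B. \<bar>x b\<bar>) > 0" using that by (simp add: less_le sum_nonneg)
    ultimately show ?thesis
      unfolding K_def P_def
      by (auto simp: abs_le_iff divide_le_eq le_divide_eq PiE_iff abs_divide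
          sum_divide_distrib[symmetric] minus_le_iff)
  qed
  have "K \<noteq> {}" using norm1[of "\<lambda>_. 1"] False \<open>finite B\<close> by auto
  then obtain x0 where x0: "x0 \<in> K" "\<And>x. x \<in> K \<Longrightarrow> F x0 \<le> F x"
    using continuous_attains_inf[OF K _ \<open>continuous_on K F\<close>] by blast
  have "F x0 \<noteq> 0"
  proof
    assume "F x0 = 0"
    then have "(\<Sum>v\<in>e ` B. x0 (inv_into B e v) *\<^sub>R v) = 0"
      using \<open>inj_on e B\<close> by (simp add: F_def sum.reindex cong: sum.cong)
    then have "x0 (inv_into B e (e b)) = 0" if "b \<in> B" for b
      using independentD[OF assms(3) _ subset_refl, of "\<lambda>v. x0 (inv_into B e v)"] that \<open>finite B\<close> by blast
    then have "(\<Sum>b\<in>B. \<bar>x0 b\<bar>) = 0" using \<open>inj_on e B\<close> by simp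
    then show False using x0(1) by (simp add: K_def)
  qed
  then have pos: "F x0 > 0" by (simp add: F_def)
  show ?thesis
  proof (rule that)
    show "1 / F x0 > 0" using pos by simp
    fix x :: "'i \<Rightarrow> real"
    define s where "s = (\<Sum>b\<in>B. \<bar>x b\<bar>)"
    show "(\<Sum>b\<in>B. \<bar>x b\<bar>) \<le> 1 / F x0 * norm (\<Sum>b\<in>B. x b *\<^sub>R e b)"
    proof (cases "s = 0")
      case False
      have "s \<ge> 0" by (simp add: s_def sum_nonneg)
      have "F x0 \<le> norm (\<Sum>b\<in>B. (x b / s) *\<^sub>R e b)"
        using x0(2)[OF norm1[of x]] False by (simp add: F_def s_def cong: sum.cong)
      also have "(\<Sum>b\<in>B. (x b / s) *\<^sub>R e b) = (1 / s) *\<^sub>R (\<Sum>b\<in>B. x b *\<^sub>R e b)"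
        by (simp add: scaleR_sum_right)
      finally show ?thesis
        using pos False \<open>s \<ge> 0\<close> by (simp add: s_def[symmetric] field_simps)
    qed (use pos s_def in auto)
  qed
qed

lemma additive_zmul:
  fixes f :: "'g::ab_group_add \<Rightarrow> 'w::real_vector"
  assumes "Modules.additive f"
  shows "f (zmul n \<gamma>) = real_of_int n *\<^sub>R f \<gamma>"
proof -
  interpret additive f by fact
  show ?thesis
    by (cases "n \<ge> 0") (auto simp: zmul_def diff minus sum sum_constant_scaleR)
qed

section \<open>Discreteness of the lattice and bounds for additive maps\<close>

context real_scalar_extension
begin

text \<open>The integral basis is sent to independent vectors, so \<open>coordinate_bound\<close>
  controls the integer coordinates by the norm. Finiteness of lattice balls, triviality of the
  kernel of \<open>\<iota>\<close> and uniform bounds on additive maps rest on this.\<close>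

lemma lattice_coordinates:
  obtains B C where "finite B" and "C > 0"
    and "\<And>\<gamma>. \<exists>n. \<gamma> = (\<Sum>b\<in>B. zmul (n b) b) \<and> (\<forall>b\<in>B. \<bar>real_of_int (n b)\<bar> \<le> C * norm (\<iota> \<gamma>))"
proof -
  obtain B where B: "finite B" "int_module.span B = (UNIV :: 'g set)"
    "inj_on \<iota> B" "independent (\<iota> ` B)" using ex_basis by blast
  obtain C where C: "C > 0"
    "\<And>x. (\<Sum>b\<in>B. \<bar>x b\<bar>) \<le> C * norm (\<Sum>b\<in>B. x b *\<^sub>R \<iota> b)"
    using coordinate_bound[OF B(1,3,4)] by blast
  show ?thesis
  proof (rule that[OF B(1) C(1)])
    fix \<gamma>
    have "\<gamma> \<in> int_module.span B" using B(2) by simp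
    then obtain n where n: "\<gamma> = (\<Sum>b\<in>B. zmul (n b) b)"
      unfolding int_module.span_finite[OF B(1)] by blast
    then have \<iota>: "\<iota> \<gamma> = (\<Sum>b\<in>B. real_of_int (n b) *\<^sub>R \<iota> b)"
      by (simp add: sum additive_zmul[OF additive_axioms])
    have "\<bar>real_of_int (n b)\<bar> \<le> C * norm (\<iota> \<gamma>)" if "b \<in> B" for b
      using member_le_sum[of b B "\<lambda>b. \<bar>real_of_int (n b)\<bar>"] that B(1) C(2)[of "\<lambda>b. real_of_int (n b)"]
      by (simp add: \<iota>)
    with n show "\<exists>n. \<gamma> = (\<Sum>b\<in>B. zmul (n b) b) \<and>
        (\<forall>b\<in>B. \<bar>real_of_int (n b)\<bar> \<le> C * norm (\<iota> \<gamma>))" by blast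
  qed
qed

lemma finite_lattice_ball: "finite {\<gamma>. norm (\<iota> \<gamma>) \<le> R}"
proof -
  obtain B C where B: "finite B" "C > 0"
    "\<And>\<gamma>. \<exists>n. \<gamma> = (\<Sum>b\<in>B. zmul (n b) b) \<and> (\<forall>b\<in>B. \<bar>real_of_int (n b)\<bar> \<le> C * norm (\<iota> \<gamma>))"
    using lattice_coordinates by blast
  define N where "N = \<lceil>C * R\<rceil>"
  have "\<gamma> \<in> (\<lambda>n. \<Sum>b\<in>B. zmul (n b) b) ` (\<Pi>\<^sub>E b\<in>B. {-N..N})" if "norm (\<iota> \<gamma>) \<le> R" for \<gamma>
  proof -
    obtain n where n: "\<gamma> = (\<Sum>b\<in>B. zmul (n b) b)"
      "\<forall>b\<in>B. \<bar>real_of_int (n b)\<bar> \<le> C * norm (\<iota> \<gamma>)" using B(3) by blast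
    have "\<bar>n b\<bar> \<le> N" if "b \<in> B" for b
    proof -
      have "\<bar>real_of_int (n b)\<bar> \<le> C * R"
        using n(2) that B(2) \<open>norm (\<iota> \<gamma>) \<le> R\<close>
        by (meson mult_left_mono order_trans less_imp_le)
      then show ?thesis unfolding N_def by linarith
    qed
    then have "restrict n B \<in> (\<Pi>\<^sub>E b\<in>B. {-N..N})" by (auto simp: abs_le_iff minus_le_iff)
    moreover have "\<gamma> = (\<Sum>b\<in>B. zmul (restrict n B b) b)" using n(1) by simp
    ultimately show ?thesis by blast
  qed
  then have "{\<gamma>. norm (\<iota> \<gamma>) \<le> R} \<subseteq> (\<lambda>n. \<Sum>b\<in>B. zmul (n b) b) ` (\<Pi>\<^sub>E b\<in>B. {-N..N})"
    by blast
  moreover have "finite (\<Pi>\<^sub>E b\<in>B. {-N..N})" by (intro finite_PiE B(1)) simp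
  ultimately show ?thesis by (meson finite_imageI finite_subset)
qed

lemma countable_lattice: "countable (UNIV :: 'g set)"
proof -
  have "(UNIV :: 'g set) = (\<Union>n::nat. {\<gamma>. norm (\<iota> \<gamma>) \<le> real n})"
    by (auto simp: real_arch_simple)
  then show ?thesis using finite_lattice_ball by (metis countable_UN countable_finite countableI_type)
qed

lemma \<iota>_eq_0_iff: "\<iota> \<gamma> = 0 \<longleftrightarrow> \<gamma> = 0"
proof
  assume "\<iota> \<gamma> = 0"
  obtain B C where B: "finite B" "C > 0"
    "\<And>\<gamma>. \<exists>n. \<gamma> = (\<Sum>b\<in>B. zmul (n b) b) \<and> (\<forall>b\<in>B. \<bar>real_of_int (n b)\<bar> \<le> C * norm (\<iota> \<gamma>))"
    using lattice_coordinates by blast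
  then obtain n where "\<gamma> = (\<Sum>b\<in>B. zmul (n b) b)" "\<forall>b\<in>B. n b = 0"
    using \<open>\<iota> \<gamma> = 0\<close> B(3)[of \<gamma>] by auto
  then show "\<gamma> = 0" by simp
qed (simp add: zero)

text \<open>\<open>B\<close> and \<open>C\<close> are chosen before \<open>f\<close>, so closeness
  of two central charges on the finite set \<open>B\<close> gives closeness relative to the norm on
  the whole lattice.\<close>

lemma additive_bound:
  obtains B C where "finite B" and "C > 0"
    and "\<And>f \<gamma>. Modules.additive f \<Longrightarrow>
      cmod (f \<gamma>) \<le> C * (\<Sum>b\<in>B. cmod (f b)) * norm (\<iota> \<gamma>)"
proof -
  obtain B C where B: "finite B" "C > 0"
    "\<And>\<gamma>. \<exists>n. \<gamma> = (\<Sum>b\<in>B. zmul (n b) b) \<and> (\<forall>b\<in>B. \<bar>real_of_int (n b)\<bar> \<le> C * norm (\<iota> \<gamma>))"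
    using lattice_coordinates by blast
  show ?thesis
  proof (rule that[OF B(1,2)])
    fix f :: "'g \<Rightarrow> complex" and \<gamma> assume f: "Modules.additive f"
    obtain n where n: "\<gamma> = (\<Sum>b\<in>B. zmul (n b) b)"
      "\<forall>b\<in>B. \<bar>real_of_int (n b)\<bar> \<le> C * norm (\<iota> \<gamma>)" using B(3) by blast
    have "cmod (f \<gamma>) \<le> (\<Sum>b\<in>B. cmod (real_of_int (n b) *\<^sub>R f b))"
      unfolding n(1) additive.sum[OF f] additive_zmul[OF f] by (rule norm_sum)
    also have "\<dots> \<le> (\<Sum>b\<in>B. (C * norm (\<iota> \<gamma>)) * cmod (f b))"
      using n(2) by (intro sum_mono) (simp add: mult_right_mono)
    finally show "cmod (f \<gamma>) \<le> C * (\<Sum>b\<in>B. cmod (f b)) * norm (\<iota> \<gamma>)"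
      by (simp add: sum_distrib_left mult_ac)
  qed
qed

text \<open>Prescribing the values on the basis gives a linear extension, and the basis spans, so it
  is unique: the description in \<open>real_extension\<close> denotes.\<close>

lemma real_extension_linear:
  assumes f: "Modules.additive f"
  shows "linear (real_extension \<iota> f)" and "real_extension \<iota> f (\<iota> \<gamma>) = f \<gamma>"
proof -
  obtain B where B: "finite B" "int_module.span B = (UNIV :: 'g set)"
    "inj_on \<iota> B" "independent (\<iota> ` B)" "span (\<iota> ` B) = UNIV" using ex_basis by blast
  obtain F where F: "linear F" "\<And>v. v \<in> \<iota> ` B \<Longrightarrow> F v = f (inv_into B \<iota> v)"
    using linear_independent_extend[OF B(4), of "\<lambda>v. f (inv_into B \<iota> v)"] by blast
  have on_lattice: "H (\<iota> \<gamma>) = f \<gamma>" if "linear H" "\<And>b. b \<in> B \<Longrightarrow> H (\<iota> b) = f b" for H \<gamma>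
  proof -
    have "\<gamma> \<in> int_module.span B" using B(2) by simp
    then obtain n where n: "\<gamma> = (\<Sum>b\<in>B. zmul (n b) b)"
      unfolding int_module.span_finite[OF B(1)] by blast
    show ?thesis
      using that
      by (simp add: n sum additive.sum[OF f] additive_zmul[OF f] additive_zmul[OF additive_axioms]
          linear_sum linear_cmul)
  qed
  have "\<exists>!F. linear F \<and> (\<forall>\<gamma>. F (\<iota> \<gamma>) = f \<gamma>)"
  proof (rule ex1I[of _ F])
    show "linear F \<and> (\<forall>\<gamma>. F (\<iota> \<gamma>) = f \<gamma>)" using F B(3) by (auto intro: on_lattice)
    fix H assume H: "linear H \<and> (\<forall>\<gamma>. H (\<iota> \<gamma>) = f \<gamma>)"
    then have on_basis: "H v = F v" if "v \<in> \<iota> ` B" for v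
      using F(2)[OF that] that B(3) by auto
    show "H = F"
    proof
      fix v
      have "v \<in> span (\<iota> ` B)" using B(5) by simp
      then show "H v = F v" by (rule linear_eq_on[OF conjunct1[OF H] F(1) _ on_basis])
    qed
  qed
  from theI'[OF this] show "linear (real_extension \<iota> f)" "real_extension \<iota> f (\<iota> \<gamma>) = f \<gamma>"
    unfolding real_extension_def by auto
qed

end

section \<open>The Baker-Campbell-Hausdorff product degree by degree\<close>

definition add_closed :: "'g::ab_group_add set \<Rightarrow> bool" where
  "add_closed S \<longleftrightarrow> (\<forall>\<alpha>\<in>S. \<forall>\<beta>\<in>S. \<alpha> + \<beta> \<in> S)"

text \<open>Contrapositively, adding an element of \<open>S\<close> to one of \<open>S - D\<close>
  never leads into \<open>D\<close>. Functions supported on \<open>S - D\<close> thus behave as an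
  ideal, and computing in the degrees of \<open>D\<close> is computing in the quotient.\<close>

definition divisor_closed :: "'g::ab_group_add set \<Rightarrow> 'g set \<Rightarrow> bool" where
  "divisor_closed S D \<longleftrightarrow> (\<forall>\<alpha>\<in>S. \<forall>\<beta>\<in>S. \<alpha> + \<beta> \<in> D \<longrightarrow> \<alpha> \<in> D \<and> \<beta> \<in> D)"

definition additive_hull :: "'g::ab_group_add set \<Rightarrow> 'g set" where
  "additive_hull P = {sum_list xs |xs. xs \<noteq> [] \<and> set xs \<subseteq> P}"

lemma add_closed_hull: "add_closed (additive_hull P)"
  unfolding add_closed_def
proof (intro ballI)
  fix \<alpha> \<beta> assume "\<alpha> \<in> additive_hull P" "\<beta> \<in> additive_hull P"
  then obtain xs ys where "\<alpha> = sum_list xs" "xs \<noteq> []" "set xs \<subseteq> P"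
    "\<beta> = sum_list ys" "ys \<noteq> []" "set ys \<subseteq> P" by (auto simp: additive_hull_def)
  then have "\<alpha> + \<beta> = sum_list (xs @ ys)" "xs @ ys \<noteq> []" "set (xs @ ys) \<subseteq> P" by auto
  then show "\<alpha> + \<beta> \<in> additive_hull P" unfolding additive_hull_def by blast
qed

lemma additive_hull_base: "\<alpha> \<in> P \<Longrightarrow> \<alpha> \<in> additive_hull P"
  unfolding additive_hull_def by (auto intro!: exI[of _ "[\<alpha>]"])

lemma additive_hull_subset:
  assumes "add_closed S" and "P \<subseteq> S"
  shows "additive_hull P \<subseteq> S"
proof -
  have "sum_list xs \<in> S" if "xs \<noteq> []" "set xs \<subseteq> S" for xs
    using that
  proof (induction xs rule: list_nonempty_induct)
    case (cons x xs)
    then show ?case using assms(1) by (auto simp: add_closed_def)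
  qed auto
  then show ?thesis using assms(2) by (auto simp: additive_hull_def)
qed

lemma additive_hull_add_decomposition:
  assumes "\<alpha> \<in> additive_hull P" and "\<beta> \<in> additive_hull P"
  obtains xs where "length xs \<ge> 2" "set xs \<subseteq> P" "sum_list xs = \<alpha> + \<beta>"
proof -
  obtain xs ys where *: "\<alpha> = sum_list xs" "xs \<noteq> []" "set xs \<subseteq> P"
    "\<beta> = sum_list ys" "ys \<noteq> []" "set ys \<subseteq> P" using assms by (auto simp: additive_hull_def)
  then have "length xs + length ys \<ge> 2" by (cases xs; cases ys) auto
  then show ?thesis using * that[of "xs @ ys"] by simp
qed

section \<open>Words in Dynkin's series\<close>

lemma dynkin_word_Cons:
  "dynkin_word x y ((r, s) # ps) = replicate r x @ replicate s y @ dynkin_word x y ps"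
  by (simp add: dynkin_word_def)

lemma set_dynkin_word: "set (dynkin_word x y ps) \<subseteq> {x, y}"
proof (induction ps)
  case (Cons p ps)
  have "set (replicate n x) \<subseteq> {x, y}" "set (replicate n y) \<subseteq> {x, y}" for n
    by (auto simp only: in_set_replicate insert_iff)
  then show ?case using Cons by (cases p) (simp only: dynkin_word_Cons set_append Un_subset_iff)
qed (simp add: dynkin_word_def)

lemma length_dynkin_word: "length (dynkin_word x y ps) = (\<Sum>(r, s)\<leftarrow>ps. r + s)"
  by (induction ps) (auto simp: dynkin_word_def)

lemma list_all2_dynkin_word:
  assumes "P x x'" and "P y y'"
  shows "list_all2 P (dynkin_word x y ps) (dynkin_word x' y' ps)"
proof -
  have rep: "list_all2 P (replicate n u) (replicate n u')" if "P u u'" for n u u'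
    using that by (induction n) auto
  show ?thesis
    using assms by (induction ps) (auto simp: dynkin_word_def intro!: list_all2_appendI rep)
qed

lemma dynkin_index_word_nonempty: "ps \<in> dynkin_index \<Longrightarrow> dynkin_word x y ps \<noteq> []"
  by (cases ps) (auto simp: dynkin_index_def dynkin_word_def)

text \<open>Every pair supplies at least one letter, so a one-letter word comes from a single pair.
  These two indices carry the linear terms of the series.\<close>

lemma dynkin_index_short:
  assumes "ps \<in> dynkin_index" and "length (dynkin_word x y ps) < 2"
  shows "ps = [(1, 0)] \<or> ps = [(0, 1)]"
proof -
  have sum: "(\<Sum>(r, s)\<leftarrow>ps. r + s) < 2" using assms(2) by (simp add: length_dynkin_word)
  obtain r s qs where ps: "ps = (r, s) # qs" "r + s > 0"
    using assms(1) by (cases ps) (auto simp: dynkin_index_def)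
  have "qs = []"
  proof (cases qs)
    case (Cons q qs')
    then have "fst q + snd q > 0" using assms(1) ps by (auto simp: dynkin_index_def)
    then show ?thesis using sum ps Cons by (auto split: prod.splits)
  qed
  then show ?thesis using sum ps by auto
qed

context graded_lie_algebra
begin

section \<open>Brackets in the completed algebra\<close>

lemma br_antisym: "br u v = - br v u"
proof -
  have "0 = br (u + v) (u + v)" by (simp add: br_alternating)
  also have "\<dots> = br u v + br v u"
    unfolding module_hom.add[OF br_linear_left] module_hom.add[OF br_linear_right]
    by (simp add: br_alternating)
  finally show ?thesis by (metis eq_neg_iff_add_eq_0)
qed

lemma double_eq_0:
  fixes u :: 'a
  assumes "u + u = 0"
  shows "u = 0"
proof -
  have "\<phi> (1/2) + \<phi> (1/2) = 1" by (simp add: rat_add[symmetric] rat_one)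
  then have "u = scale (\<phi> (1/2)) (u + u)"
    by (metis scale_left_distrib scale_one scale_right_distrib)
  then show ?thesis using assms by simp
qed

lemma hbr_nonzero:
  assumes "hbr a b \<gamma> \<noteq> 0"
  obtains \<alpha> where "\<alpha> \<in> supp a" "\<gamma> - \<alpha> \<in> supp b"
proof -
  have "{\<alpha>. a \<alpha> \<noteq> 0 \<and> b (\<gamma> - \<alpha>) \<noteq> 0} \<noteq> {}"
    using assms unfolding hbr_def by (metis sum.empty)
  then show ?thesis using that by (auto simp: supp_def)
qed

lemma hbr_zero_left: "hbr (\<lambda>_. 0) b = (\<lambda>_. 0)"
  by (simp add: hbr_def)

lemma hbr_zero_right: "hbr a (\<lambda>_. 0) = (\<lambda>_. 0)"
  by (simp add: hbr_def)

text \<open>The substitution \<alpha> to \<gamma> - \<alpha> exchanges the two factors, so each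
  component equals its own negative. Where the index set is infinite both sums are 0 by
  convention.\<close>

lemma hbr_self: "hbr a a = (\<lambda>_. 0)"
proof
  fix \<gamma>
  have "hbr a a \<gamma> = (\<Sum>\<alpha> | a \<alpha> \<noteq> 0 \<and> a (\<gamma> - \<alpha>) \<noteq> 0. br (a (\<gamma> - \<alpha>)) (a \<alpha>))"
    unfolding hbr_def
    by (rule sum.reindex_bij_witness[where i = "\<lambda>\<alpha>. \<gamma> - \<alpha>" and j = "\<lambda>\<alpha>. \<gamma> - \<alpha>"]) auto
  also have "\<dots> = (\<Sum>\<alpha> | a \<alpha> \<noteq> 0 \<and> a (\<gamma> - \<alpha>) \<noteq> 0. - br (a \<alpha>) (a (\<gamma> - \<alpha>)))"
    by (intro sum.cong refl br_antisym)
  also have "\<dots> = - hbr a a \<gamma>" by (simp add: hbr_def sum_negf)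
  finally have "hbr a a \<gamma> + hbr a a \<gamma> = 0" unfolding eq_neg_iff_add_eq_0 .
  then show "hbr a a \<gamma> = 0" by (rule double_eq_0)
qed

lemma hbr_graded:
  assumes "\<And>\<gamma>. a \<gamma> \<in> G \<gamma>" and "\<And>\<gamma>. b \<gamma> \<in> G \<gamma>"
  shows "hbr a b \<gamma> \<in> G \<gamma>"
  unfolding hbr_def using br_graded[OF assms(1) assms(2), of _ "\<gamma> - _"]
  by (intro subspace_sum[OF graded_subspace]) (metis add_diff_cancel_left' diff_add_cancel add.commute)

lemma nested_hbr_supp:
  assumes "add_closed S" and "xs \<noteq> []" and "\<And>x. x \<in> set xs \<Longrightarrow> supp x \<subseteq> S"
  shows "supp (nested_hbr xs) \<subseteq> S"
  using assms(2,3)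
proof (induction xs rule: nested_hbr.induct)
  case (3 a b as)
  then have IH: "supp a \<subseteq> S" "supp (nested_hbr (b # as)) \<subseteq> S" by auto
  show ?case
  proof
    fix \<gamma> assume "\<gamma> \<in> supp (nested_hbr (a # b # as))"
    then obtain \<alpha> where "\<alpha> \<in> supp a" "\<gamma> - \<alpha> \<in> supp (nested_hbr (b # as))"
      by (auto simp: supp_def elim!: hbr_nonzero)
    then have "\<alpha> + (\<gamma> - \<alpha>) \<in> S" using IH assms(1) unfolding add_closed_def by blast
    then show "\<gamma> \<in> S" by simp
  qed
qed auto

text \<open>The outermost bracket splits the degree between the first letter and the rest of the
  word. In a degree that does not split inside \<open>S\<close>, all words of length at least 2
  therefore vanish.\<close>

lemma nested_hbr_decomposition:
  assumes "add_closed S" and "length xs \<ge> 2" and "\<And>x. x \<in> set xs \<Longrightarrow> supp x \<subseteq> S"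
    and "nested_hbr xs \<gamma> \<noteq> 0"
  obtains \<alpha> where "\<alpha> \<in> S" "\<gamma> - \<alpha> \<in> S"
proof -
  obtain a b as where xs: "xs = a # b # as"
    using assms(2) by (metis One_nat_def Suc_1 Suc_le_length_iff)
  have "supp (nested_hbr (b # as)) \<subseteq> S"
    using assms(3) unfolding xs by (intro nested_hbr_supp[OF assms(1)]; simp)
  moreover have "supp a \<subseteq> S" using assms(3) unfolding xs by simp
  ultimately show ?thesis using assms(4) that unfolding xs by (auto elim!: hbr_nonzero)
qed

lemma nested_hbr_graded:
  assumes "xs \<noteq> []" and "\<And>x \<gamma>. x \<in> set xs \<Longrightarrow> x \<gamma> \<in> G \<gamma>"
  shows "nested_hbr xs \<gamma> \<in> G \<gamma>"
  using assms
proof (induction xs arbitrary: \<gamma> rule: nested_hbr.induct)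
  case (3 a b as)
  then show ?case by (auto intro!: hbr_graded)
qed auto

text \<open>A term of the sum in degree \<gamma> splits \<gamma> inside \<open>S\<close>. Both parts
  then lie in \<open>D\<close>, where the functions coincide, so the index sets and the summands are
  the same.\<close>

lemma hbr_agree:
  assumes "divisor_closed S D" "supp a \<subseteq> S" "supp a' \<subseteq> S" "supp b \<subseteq> S" "supp b' \<subseteq> S"
    and "\<And>\<gamma>. \<gamma> \<in> D \<Longrightarrow> a \<gamma> = a' \<gamma>" "\<And>\<gamma>. \<gamma> \<in> D \<Longrightarrow> b \<gamma> = b' \<gamma>" and "\<gamma> \<in> D"
  shows "hbr a b \<gamma> = hbr a' b' \<gamma>"
proof -
  have D: "\<alpha> \<in> D \<and> \<gamma> - \<alpha> \<in> D" if "\<alpha> \<in> S" "\<gamma> - \<alpha> \<in> S" for \<alpha>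
    using assms(1,8) that by (auto simp: divisor_closed_def dest!: bspec)
  have "a \<alpha> = a' \<alpha> \<and> b (\<gamma> - \<alpha>) = b' (\<gamma> - \<alpha>)"
    if "a \<alpha> \<noteq> 0 \<and> b (\<gamma> - \<alpha>) \<noteq> 0 \<or> a' \<alpha> \<noteq> 0 \<and> b' (\<gamma> - \<alpha>) \<noteq> 0" for \<alpha>
    using that D[of \<alpha>] assms(2-7) unfolding supp_def by blast
  then show ?thesis unfolding hbr_def by (intro sum.cong) (auto, (metis+)?)
qed

lemma nested_hbr_agree:
  assumes "add_closed S" "divisor_closed S D"
    and "list_all2 (\<lambda>a a'. supp a \<subseteq> S \<and> supp a' \<subseteq> S \<and> (\<forall>\<gamma>\<in>D. a \<gamma> = a' \<gamma>)) xs ys"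
    and "\<gamma> \<in> D"
  shows "nested_hbr xs \<gamma> = nested_hbr ys \<gamma>"
  using assms(3,4)
proof (induction xs arbitrary: ys \<gamma> rule: nested_hbr.induct)
  case (3 a b as)
  then obtain a' b' as' where ys: "ys = a' # b' # as'" by (auto simp: list_all2_Cons1)
  have head: "supp a \<subseteq> S" "supp a' \<subseteq> S" "\<And>\<gamma>. \<gamma> \<in> D \<Longrightarrow> a \<gamma> = a' \<gamma>"
    and tail: "list_all2 (\<lambda>a a'. supp a \<subseteq> S \<and> supp a' \<subseteq> S \<and> (\<forall>\<gamma>\<in>D. a \<gamma> = a' \<gamma>)) (b # as) (b' # as')"
    using 3(2) unfolding ys by simp_all
  have set_supp: "(\<forall>x\<in>set us. supp x \<subseteq> S) \<and> (\<forall>x\<in>set vs. supp x \<subseteq> S)"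
    if "list_all2 (\<lambda>a a'. supp a \<subseteq> S \<and> supp a' \<subseteq> S \<and> (\<forall>\<gamma>\<in>D. a \<gamma> = a' \<gamma>)) us vs" for us vs
    using that by (induction rule: list_all2_induct) auto
  have supps: "supp (nested_hbr (b # as)) \<subseteq> S" "supp (nested_hbr (b' # as')) \<subseteq> S"
    using set_supp[OF tail] by (metis nested_hbr_supp[OF assms(1)] list.distinct(1))+
  show ?case
    unfolding ys nested_hbr.simps
    by (rule hbr_agree[OF assms(2) head(1,2) supps head(3) 3(1)[OF tail] 3(3)])
qed (auto simp: list_all2_Cons1)

section \<open>The Baker-Campbell-Hausdorff product in a fixed degree\<close>

lemma bch_linear_part:
  assumes "\<And>ps. ps \<in> dynkin_index \<Longrightarrow> length (dynkin_word a b ps) \<ge> 2 \<Longrightarrow>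
    nested_hbr (dynkin_word a b ps) \<gamma> = 0"
  shows "bch a b \<gamma> = a \<gamma> + b \<gamma>"
proof -
  let ?f = "\<lambda>ps. scale (\<phi> (dynkin_coeff ps)) (nested_hbr (dynkin_word a b ps) \<gamma>)"
  let ?I = "{[(1, 0)], [(0, 1)]} :: (nat \<times> nat) list set"
  have "bch a b \<gamma> = sum ?f ?I"
    unfolding bch_def
  proof (rule sum.mono_neutral_left)
    show "{ps \<in> dynkin_index. nested_hbr (dynkin_word a b ps) \<gamma> \<noteq> 0} \<subseteq> ?I"
      using assms dynkin_index_short by (force simp: not_less)
    show "\<forall>ps\<in>?I - {ps \<in> dynkin_index. nested_hbr (dynkin_word a b ps) \<gamma> \<noteq> 0}. ?f ps = 0"
      by (auto simp: dynkin_index_def)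
  qed simp
  then show ?thesis by (simp add: dynkin_coeff_def dynkin_word_def rat_one)
qed

text \<open>In a word of at least two letters from 0 and \<open>b\<close>, the innermost bracket
  either contains 0 or is the bracket of \<open>b\<close> with itself, so the word evaluates to
  0.\<close>

lemma bch_zero_left: "bch (\<lambda>_. 0) b = b"
proof
  fix \<gamma>
  have "nested_hbr xs = (\<lambda>_. 0)" if "length xs \<ge> 2" "set xs \<subseteq> {\<lambda>_. 0, b}" for xs
    using that
  proof (induction xs rule: nested_hbr.induct)
    case (3 x y zs)
    show ?case
    proof (cases zs)
      case Nil
      then show ?thesis using 3 by (auto simp: hbr_zero_left hbr_zero_right hbr_self)
    next
      case (Cons z zs')
      then show ?thesis using 3 by (simp add: hbr_zero_right)
    qed
  qed auto
  then have "nested_hbr (dynkin_word (\<lambda>_. 0) b ps) = (\<lambda>_. 0)"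
    if "length (dynkin_word (\<lambda>_. 0) b ps) \<ge> 2" for ps
    using that set_dynkin_word[of "\<lambda>_. 0" b ps] by blast
  then show "bch (\<lambda>_. 0) b \<gamma> = b \<gamma>"
    by (subst bch_linear_part) auto
qed

text \<open>A bracket of two or more letters would split \<gamma> inside \<open>S\<close>, so only
  the linear terms of the series reach this degree.\<close>

lemma bch_indecomposable:
  assumes "add_closed S" and "supp a \<subseteq> S" and "supp b \<subseteq> S"
    and "\<And>\<alpha>. \<alpha> \<in> S \<Longrightarrow> \<gamma> - \<alpha> \<notin> S"
  shows "bch a b \<gamma> = a \<gamma> + b \<gamma>"
proof (rule bch_linear_part)
  fix ps assume len: "length (dynkin_word a b ps) \<ge> 2"
  have "supp x \<subseteq> S" if "x \<in> set (dynkin_word a b ps)" for x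
    using that set_dynkin_word[of a b ps] assms(2,3) by auto
  then show "nested_hbr (dynkin_word a b ps) \<gamma> = 0"
    using nested_hbr_decomposition[OF assms(1) len] assms(4) by metis
qed

lemma bch_supp:
  assumes "add_closed S" and "supp a \<subseteq> S" and "supp b \<subseteq> S"
  shows "supp (bch a b) \<subseteq> S"
proof
  fix \<gamma> assume \<gamma>: "\<gamma> \<in> supp (bch a b)"
  have "{ps \<in> dynkin_index. nested_hbr (dynkin_word a b ps) \<gamma> \<noteq> 0} \<noteq> {}"
  proof
    assume "{ps \<in> dynkin_index. nested_hbr (dynkin_word a b ps) \<gamma> \<noteq> 0} = {}"
    then have "bch a b \<gamma> = 0" unfolding bch_def by simp
    then show False using \<gamma> by (simp add: supp_def)
  qed
  then obtain ps where "ps \<in> dynkin_index" "\<gamma> \<in> supp (nested_hbr (dynkin_word a b ps))"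
    by (auto simp: supp_def)
  moreover have "supp (nested_hbr (dynkin_word a b ps)) \<subseteq> S"
    using set_dynkin_word[of a b ps] assms(2,3)
    by (intro nested_hbr_supp assms(1) dynkin_index_word_nonempty calculation) auto
  ultimately show "\<gamma> \<in> S" by blast
qed

lemma bch_graded:
  assumes "\<And>\<gamma>. a \<gamma> \<in> G \<gamma>" and "\<And>\<gamma>. b \<gamma> \<in> G \<gamma>"
  shows "bch a b \<gamma> \<in> G \<gamma>"
  unfolding bch_def
proof (intro subspace_sum subspace_scale graded_subspace)
  fix ps assume "ps \<in> {ps \<in> dynkin_index. nested_hbr (dynkin_word a b ps) \<gamma> \<noteq> 0}"
  then show "nested_hbr (dynkin_word a b ps) \<gamma> \<in> G \<gamma>"
    using set_dynkin_word[of a b ps] assms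
    by (intro nested_hbr_graded dynkin_index_word_nonempty) auto
qed

text \<open>This makes the product well defined on the truncation to \<open>D\<close>: every word of
  the series has the same value there for both pairs.\<close>

lemma bch_agree:
  assumes "add_closed S" "divisor_closed S D"
    and "supp a \<subseteq> S" "supp a' \<subseteq> S" "supp b \<subseteq> S" "supp b' \<subseteq> S"
    and "\<And>\<gamma>. \<gamma> \<in> D \<Longrightarrow> a \<gamma> = a' \<gamma>" "\<And>\<gamma>. \<gamma> \<in> D \<Longrightarrow> b \<gamma> = b' \<gamma>" and "\<gamma> \<in> D"
  shows "bch a b \<gamma> = bch a' b' \<gamma>"
proof -
  have "nested_hbr (dynkin_word a b ps) \<gamma> = nested_hbr (dynkin_word a' b' ps) \<gamma>" for ps
    using assms by (intro nested_hbr_agree[of S D] list_all2_dynkin_word) auto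
  then show ?thesis by (simp add: bch_def)
qed

section \<open>Logarithms of finite ordered products\<close>

definition product_log :: "('g \<Rightarrow> complex) \<Rightarrow> ('g \<Rightarrow> 'a) \<Rightarrow> complex set list \<Rightarrow> 'g \<Rightarrow> 'a" where
  "product_log Z a ls = foldr (\<lambda>l. bch (ray_part Z a l)) ls (\<lambda>_. 0)"

lemma product_log_simps [simp]:
  "product_log Z a [] = (\<lambda>_. 0)"
  "product_log Z a (l # ls) = bch (ray_part Z a l) (product_log Z a ls)"
  by (simp_all add: product_log_def)

lemma Log_ordered_product:
  "Log (ordered_product Z a R) = product_log Z a (clockwise_list R)"
proof -
  have "Log (foldr Ghat_mult (map (\<lambda>l. Exp (ray_part Z a l)) ls) Ghat_one) = product_log Z a ls"
    for ls by (induction ls) (simp_all add: Ghat_one_def Ghat_mult_def)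
  then show ?thesis by (simp add: ordered_product_def)
qed

lemma product_log_supp:
  assumes "add_closed S" and "\<And>l. l \<in> set ls \<Longrightarrow> supp (ray_part Z a l) \<subseteq> S"
  shows "supp (product_log Z a ls) \<subseteq> S"
  using assms(2)
proof (induction ls)
  case (Cons l ls)
  then show ?case unfolding product_log_simps by (intro bch_supp[OF assms(1)]) auto
qed (simp add: supp_def)

lemma product_log_graded:
  assumes "\<And>\<gamma>. a \<gamma> \<in> G \<gamma>"
  shows "product_log Z a ls \<gamma> \<in> G \<gamma>"
  by (induction ls arbitrary: \<gamma>)
    (auto intro!: bch_graded simp: ray_part_def assms subspace_0[OF graded_subspace])

lemma product_log_filter:
  assumes "add_closed S" "divisor_closed S D"
    and "\<And>l. l \<in> set ls \<Longrightarrow> supp (ray_part Z a l) \<subseteq> S"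
    and "\<And>l \<gamma>. l \<in> set ls \<Longrightarrow> \<not> p l \<Longrightarrow> \<gamma> \<in> D \<Longrightarrow> ray_part Z a l \<gamma> = 0"
    and "\<gamma> \<in> D"
  shows "product_log Z a ls \<gamma> = product_log Z a (filter p ls) \<gamma>"
  using assms(3-5)
proof (induction ls arbitrary: \<gamma>)
  case (Cons l ls)
  have supps: "supp (product_log Z a ls) \<subseteq> S" "supp (product_log Z a (filter p ls)) \<subseteq> S"
    using Cons.prems(1) by (intro product_log_supp[OF assms(1)]; simp)+
  have IH: "product_log Z a ls \<delta> = product_log Z a (filter p ls) \<delta>" if "\<delta> \<in> D" for \<delta>
    using Cons that by auto
  show ?case
  proof (cases "p l")
    case True
    then show ?thesis
      using bch_agree[OF assms(1,2) _ _ supps _ IH, of "ray_part Z a l" "ray_part Z a l"] Cons.prems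
      by auto
  next
    case False
    have "bch (ray_part Z a l) (product_log Z a ls) \<gamma> = bch (\<lambda>_. 0) (product_log Z a (filter p ls)) \<gamma>"
      using Cons.prems False by (intro bch_agree[OF assms(1,2) _ _ supps _ IH]) (auto simp: supp_def)
    then show ?thesis using False by (simp add: bch_zero_left)
  qed
qed simp

lemma product_log_indecomposable:
  assumes "add_closed S" and "\<And>l. l \<in> set ls \<Longrightarrow> supp (ray_part Z a l) \<subseteq> S"
    and "\<And>\<alpha>. \<alpha> \<in> S \<Longrightarrow> \<gamma> - \<alpha> \<notin> S"
  shows "product_log Z a ls \<gamma> = (\<Sum>l\<leftarrow>ls. ray_part Z a l \<gamma>)"
  using assms(2)
proof (induction ls)
  case (Cons l ls)
  then show ?case
    using bch_indecomposable[OF assms(1) _ product_log_supp[OF assms(1)] assms(3)] by simp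
qed simp

end

section \<open>Sectors and rays\<close>

text \<open>Multiplication by \<open>cnj z0\<close> turns the ray of \<open>z0\<close> into the
  positive real axis. For \<open>c > 0\<close> this is the open sector around that ray with
  half-angle arctan c.\<close>

definition sector :: "complex \<Rightarrow> real \<Rightarrow> complex set" where
  "sector z0 c = {z. \<bar>Im (z * cnj z0)\<bar> < c * Re (z * cnj z0)}"

lemma sector_Re_pos: "z \<in> sector z0 c \<Longrightarrow> c > 0 \<Longrightarrow> Re (z * cnj z0) > 0"
  unfolding sector_def mem_Collect_eq by (metis abs_ge_zero le_less_trans zero_less_mult_pos)

lemma sector_add: "z \<in> sector z0 c \<Longrightarrow> w \<in> sector z0 c \<Longrightarrow> z + w \<in> sector z0 c"
  unfolding sector_def mem_Collect_eq distrib_right plus_complex.sel distrib_left by linarith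

lemma sector_scaleR: "z \<in> sector z0 c \<Longrightarrow> t > 0 \<Longrightarrow> t *\<^sub>R z \<in> sector z0 c"
proof -
  assume z: "z \<in> sector z0 c" and t: "t > 0"
  have "\<bar>Im (t *\<^sub>R z * cnj z0)\<bar> = t * \<bar>Im (z * cnj z0)\<bar>"
    unfolding mult_scaleR_left complex_scaleR abs_mult using t by (simp add: abs_mult)
  also have "\<dots> < t * (c * Re (z * cnj z0))" using z t by (simp add: sector_def)
  also have "\<dots> = c * Re (t *\<^sub>R z * cnj z0)" by (simp add: algebra_simps)
  finally show ?thesis unfolding sector_def mem_Collect_eq .
qed

lemma sector_self: "z0 \<noteq> 0 \<Longrightarrow> c > 0 \<Longrightarrow> z0 \<in> sector z0 c"
  by (auto simp: sector_def complex_eq_iff sum_squares_gt_zero_iff)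

text \<open>The half-angle is at most 45 degrees, so the imaginary part is dominated by the real
  part. The modulus is thereby controlled by an additive function, which bounds the summands of a
  given charge.\<close>

lemma sector_norm_bound:
  assumes "z \<in> sector z0 c" and "0 < c" and "c \<le> 1"
  shows "cmod z * cmod z0 \<le> 2 * Re (z * cnj z0)"
proof -
  have "\<bar>Im (z * cnj z0)\<bar> \<le> 1 * Re (z * cnj z0)"
    using assms(1) mult_right_mono[OF assms(3), of "Re (z * cnj z0)"] sector_Re_pos[OF assms(1,2)]
    unfolding sector_def mem_Collect_eq by linarith
  moreover have "cmod z * cmod z0 \<le> \<bar>Re (z * cnj z0)\<bar> + \<bar>Im (z * cnj z0)\<bar>"
    using cmod_le[of "z * cnj z0"] by (simp add: norm_mult)
  ultimately show ?thesis using sector_Re_pos[OF assms(1,2)] by linarith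
qed

lemma open_sector: "open (sector z0 c)"
  unfolding sector_def by (intro open_Collect_less continuous_intros)

lemma closure_sector_subset: "closure (sector z0 c) \<subseteq> {z. \<bar>Im (z * cnj z0)\<bar> \<le> c * Re (z * cnj z0)}"
  by (intro closure_minimal closed_Collect_le continuous_intros) (auto simp: sector_def)

lemma frontier_sector_subset: "frontier (sector z0 c) \<subseteq> {z. \<bar>Im (z * cnj z0)\<bar> = c * Re (z * cnj z0)}"
proof
  fix z assume "z \<in> frontier (sector z0 c)"
  then have "z \<in> closure (sector z0 c)" "z \<notin> sector z0 c"
    by (auto simp: frontier_def interior_open[OF open_sector])
  then have "\<bar>Im (z * cnj z0)\<bar> \<le> c * Re (z * cnj z0)" "\<not> \<bar>Im (z * cnj z0)\<bar> < c * Re (z * cnj z0)"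
    using closure_sector_subset[of z0 c] by (auto simp only: sector_def mem_Collect_eq)
  then show "z \<in> {z. \<bar>Im (z * cnj z0)\<bar> = c * Re (z * cnj z0)}"
    unfolding mem_Collect_eq by linarith
qed

lemma blunt_strict_cone_sector:
  assumes "z0 \<noteq> 0" and "c > 0"
  shows "blunt_strict_cone (sector z0 c)"
  unfolding blunt_strict_cone_def
proof (intro conjI notI ballI allI impI)
  show "t *\<^sub>R z \<in> sector z0 c" if "z \<in> sector z0 c" "0 < t" for z t
    using that by (rule sector_scaleR)
  show False if "0 \<in> sector z0 c" using that by (simp add: sector_def)
  show "convex (sector z0 c)"
  proof (rule convexI)
    fix z w and u v :: real
    assume *: "z \<in> sector z0 c" "w \<in> sector z0 c" "0 \<le> u" "0 \<le> v" "u + v = 1"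
    show "u *\<^sub>R z + v *\<^sub>R w \<in> sector z0 c"
    proof (cases "u = 0 \<or> v = 0")
      case True
      then show ?thesis using * by auto
    next
      case False
      then show ?thesis using * by (intro sector_add sector_scaleR) auto
    qed
  qed
  assume "\<exists>p v. v \<noteq> 0 \<and> range (\<lambda>t. p + t *\<^sub>R v) \<subseteq> closure (sector z0 c)"
  then obtain p v where v: "v \<noteq> 0" "range (\<lambda>t. p + t *\<^sub>R v) \<subseteq> closure (sector z0 c)" by blast
  define P W where "P = p * cnj z0" and "W = v * cnj z0"
  \<comment> \<open>The bound along the whole line forces \<open>W = 0\<close>: if
    \<open>Re W\<close> were nonzero, some \<open>t\<close> would make the real part -1; once it is
    0, a nonzero \<open>Im W\<close> would let the imaginary part reach
    \<open>c * Re P + 1\<close>.\<close>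
  have *: "\<bar>Im P + t * Im W\<bar> \<le> c * (Re P + t * Re W)" for t
  proof -
    have "p + t *\<^sub>R v \<in> closure (sector z0 c)" using v(2) by blast
    then have "\<bar>Im ((p + t *\<^sub>R v) * cnj z0)\<bar> \<le> c * Re ((p + t *\<^sub>R v) * cnj z0)"
      using closure_sector_subset by blast
    moreover have "(p + t *\<^sub>R v) * cnj z0 = P + t *\<^sub>R W" by (simp add: P_def W_def algebra_simps)
    ultimately show ?thesis by simp
  qed
  have "Re W = 0"
  proof (rule ccontr)
    assume "Re W \<noteq> 0"
    then have "c * (Re P + (- (Re P + 1) / Re W) * Re W) < 0" using assms(2) by simp
    then show False using *[of "- (Re P + 1) / Re W"] by linarith
  qed
  moreover have "Im W = 0"
  proof (rule ccontr)
    assume W: "Im W \<noteq> 0"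
    then have "Im P + ((c * Re P + 1 - Im P) / Im W) * Im W = c * Re P + 1" by simp
    then show False using *[of "(c * Re P + 1 - Im P) / Im W"] \<open>Re W = 0\<close> by simp
  qed
  ultimately have "W = 0" by (simp add: complex_eq_iff)
  then show False using v(1) assms(1) by (simp add: W_def)
qed

section \<open>Rays and their slopes\<close>

definition ray_through :: "complex \<Rightarrow> complex set" where
  "ray_through z = {t *\<^sub>R z |t. t > 0}"

lemma ray_through_self: "z \<in> ray_through z"
  unfolding ray_through_def by (auto intro!: exI[of _ 1])

lemma is_ray_ray_through: "z \<noteq> 0 \<Longrightarrow> is_ray (ray_through z)"
  unfolding is_ray_def ray_through_def by blast

lemma ray_through_scaleR: "s > 0 \<Longrightarrow> ray_through (s *\<^sub>R z) = ray_through z"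
proof -
  assume s: "s > 0"
  have "t *\<^sub>R z = (t / s) *\<^sub>R (s *\<^sub>R z)" "t > 0 \<Longrightarrow> t / s > 0" for t using s by auto
  moreover have "t *\<^sub>R (s *\<^sub>R z) = (t * s) *\<^sub>R z" "t > 0 \<Longrightarrow> t * s > 0" for t using s by auto
  ultimately show ?thesis unfolding ray_through_def by blast
qed

lemma is_ray_eq_ray_through: "is_ray l \<Longrightarrow> z \<in> l \<Longrightarrow> l = ray_through z"
proof -
  assume "is_ray l" "z \<in> l"
  then obtain w t where "l = ray_through w" "z = t *\<^sub>R w" "t > 0"
    by (auto simp: is_ray_def ray_through_def)
  then show ?thesis by (simp add: ray_through_scaleR)
qed

lemma mem_ray_iff: "is_ray l \<Longrightarrow> z \<in> l \<longleftrightarrow> l = ray_through z"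
  using is_ray_eq_ray_through ray_through_self by blast

lemma is_ray_nonempty: "is_ray l \<Longrightarrow> \<exists>z. z \<in> l"
  unfolding is_ray_def using ray_through_self[unfolded ray_through_def] by blast

lemma ray_through_subset_sector: "z \<in> sector z0 c \<Longrightarrow> ray_through z \<subseteq> sector z0 c"
  unfolding ray_through_def using sector_scaleR by blast

text \<open>Rays in a sector are identified with the tangents of their angles from its axis.\<close>

definition slope :: "complex \<Rightarrow> complex \<Rightarrow> real" where
  "slope z0 z = Im (z * cnj z0) / Re (z * cnj z0)"

definition ray_slope :: "complex \<Rightarrow> complex set \<Rightarrow> real" where
  "ray_slope z0 l = slope z0 (SOME z. z \<in> l)"

lemma slope_scaleR: "t > 0 \<Longrightarrow> slope z0 (t *\<^sub>R z) = slope z0 z"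
proof -
  assume "t > 0"
  moreover have "t *\<^sub>R z * cnj z0 = t *\<^sub>R (z * cnj z0)" by simp
  ultimately show ?thesis unfolding slope_def by (simp del: mult_scaleR_left complex_mult_cnj times_complex.sel)
qed

lemma ray_slope_eq: "is_ray l \<Longrightarrow> z \<in> l \<Longrightarrow> ray_slope z0 l = slope z0 z"
proof -
  assume l: "is_ray l" "z \<in> l"
  then have "(SOME z. z \<in> l) \<in> l" by (metis someI_ex)
  then obtain t where "(SOME z. z \<in> l) = t *\<^sub>R z" "t > 0"
    using is_ray_eq_ray_through[OF l] unfolding ray_through_def by auto
  then show ?thesis unfolding ray_slope_def by (simp add: slope_scaleR)
qed

lemma Im_mult_cnj_pos_iff:
  assumes "z \<in> sector z0 c" "w \<in> sector z0 c" "z0 \<noteq> 0" "c > 0"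
  shows "Im (z * cnj w) > 0 \<longleftrightarrow> slope z0 z > slope z0 w"
proof -
  have pos: "Re (z * cnj z0) > 0" "Re (w * cnj z0) > 0" using assms sector_Re_pos by auto
  \<comment> \<open>Rotating both numbers by \<open>cnj z0\<close> only scales
    \<open>z * cnj w\<close> by a positive real. The sign of its imaginary part becomes that of a 2
    by 2 determinant, and dividing by the positive real parts compares slopes.\<close>
  have "(z * cnj z0) * cnj (w * cnj z0) = (z * cnj w) * of_real ((cmod z0)\<^sup>2)"
    unfolding complex_norm_square by (simp add: mult_ac)
  then have "Im (z * cnj w) * (cmod z0)\<^sup>2 = Im ((z * cnj z0) * cnj (w * cnj z0))"
    by (metis Im_complex_of_real Re_complex_of_real add_0 mult_zero_right times_complex.sel(2) add.commute)
  also have "\<dots> = Im (z * cnj z0) * Re (w * cnj z0) - Re (z * cnj z0) * Im (w * cnj z0)"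
    by (simp add: algebra_simps)
  finally have "Im (z * cnj w) > 0 \<longleftrightarrow>
      Im (z * cnj z0) * Re (w * cnj z0) - Re (z * cnj z0) * Im (w * cnj z0) > 0"
    using assms(3) by (metis norm_eq_zero zero_less_mult_pos2 zero_less_power2 mult_pos_pos)
  also have "\<dots> \<longleftrightarrow> slope z0 z > slope z0 w"
    using pos unfolding slope_def by (simp add: field_simps del: times_complex.sel)
  finally show ?thesis .
qed

lemma clockwise_iff:
  assumes "is_ray l" "is_ray l'" "l \<subseteq> sector z0 c" "l' \<subseteq> sector z0 c" "z0 \<noteq> 0" "c > 0"
  shows "clockwise l l' \<longleftrightarrow> ray_slope z0 l > ray_slope z0 l'"
proof -
  have "Im (z * cnj w) > 0 \<longleftrightarrow> ray_slope z0 l > ray_slope z0 l'" if "z \<in> l" "w \<in> l'" for z w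
    using that assms Im_mult_cnj_pos_iff[of z z0 c w] ray_slope_eq by (metis subsetD)
  then show ?thesis unfolding clockwise_def using assms(1,2) is_ray_nonempty by metis
qed

lemma ray_slope_inj:
  assumes "z0 \<noteq> 0" "c > 0"
  shows "inj_on (ray_slope z0) {l. is_ray l \<and> l \<subseteq> sector z0 c}"
proof (rule inj_onI)
  fix l l' assume l: "l \<in> {l. is_ray l \<and> l \<subseteq> sector z0 c}" "l' \<in> {l. is_ray l \<and> l \<subseteq> sector z0 c}"
    and eq: "ray_slope z0 l = ray_slope z0 l'"
  then obtain z w where zw: "z \<in> l" "w \<in> l'" using is_ray_nonempty by blast
  define u v where "u = z * cnj z0" and "v = w * cnj z0"
  have pos: "Re u > 0" "Re v > 0" using l zw assms sector_Re_pos unfolding u_def v_def by blast+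
  have "Im u / Re u = Im v / Re v"
    using eq l zw ray_slope_eq unfolding slope_def u_def v_def by (metis mem_Collect_eq)
  then have "u = (Re u / Re v) *\<^sub>R v" using pos by (simp add: complex_eq_iff field_simps)
  then have "z * cnj z0 = ((Re u / Re v) *\<^sub>R w) * cnj z0" by (simp add: u_def v_def)
  then have "z = (Re u / Re v) *\<^sub>R w"
    using assms(1) by (metis complex_cnj_zero_iff mult_right_cancel)
  moreover have "Re u / Re v > 0" using pos by simp
  ultimately have "ray_through z = ray_through w" by (simp add: ray_through_scaleR)
  then show "l = l'" using l zw is_ray_eq_ray_through by (metis mem_Collect_eq)
qed

section \<open>Clockwise enumeration of finite sets of rays\<close>

context
  fixes z0 :: complex and c :: real and rays :: "complex set set"
  assumes z0: "z0 \<noteq> 0" and c: "c > 0"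
  defines "rays \<equiv> {l. is_ray l \<and> l \<subseteq> sector z0 c}"
begin

text \<open>Clockwise order is decreasing slope. Reversing the list of slopes gives a strictly
  increasing list of reals, for which existence and uniqueness of enumerations are known.\<close>

lemma sorted_clockwise_iff:
  assumes "set ls \<subseteq> rays"
  shows "sorted_wrt clockwise ls \<longleftrightarrow> sorted_wrt (<) (rev (map (ray_slope z0) ls))"
proof -
  have "sorted_wrt clockwise ls \<longleftrightarrow> sorted_wrt (\<lambda>l l'. ray_slope z0 l > ray_slope z0 l') ls"
  proof -
    have "clockwise l l' \<longleftrightarrow> ray_slope z0 l > ray_slope z0 l'" if "l \<in> set ls" "l' \<in> set ls" for l l'
      using assms that clockwise_iff[OF _ _ _ _ z0 c] unfolding rays_def by blast
    then show ?thesis by (auto simp: sorted_wrt_iff_nth_less)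
  qed
  then show ?thesis by (simp add: sorted_wrt_rev sorted_wrt_map)
qed

lemma sorted_clockwise_unique:
  assumes "set ls = R" "set ls' = R" "R \<subseteq> rays" "sorted_wrt clockwise ls" "sorted_wrt clockwise ls'"
  shows "ls = ls'"
proof -
  have "rev (map (ray_slope z0) ls) = rev (map (ray_slope z0) ls')"
    using assms sorted_clockwise_iff by (intro strict_sorted_equal) auto
  then show ?thesis
    using map_inj_on[of "ray_slope z0" ls ls'] inj_on_subset[OF ray_slope_inj[OF z0 c]] assms
    unfolding rays_def by auto
qed

lemma clockwise_list:
  assumes "finite R" "R \<subseteq> rays"
  shows "set (clockwise_list R) = R" and "sorted_wrt clockwise (clockwise_list R)"
proof -
  have inj: "inj_on (ray_slope z0) R" using ray_slope_inj[OF z0 c] assms(2) inj_on_subset rays_def by metis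
  let ?xs = "sorted_list_of_set (ray_slope z0 ` R)"
  let ?ls = "map (inv_into R (ray_slope z0)) (rev ?xs)"
  have set: "set ?ls = R" using assms(1) inj by simp
  have "map (ray_slope z0 \<circ> inv_into R (ray_slope z0)) ?xs = ?xs"
    using assms(1) by (intro map_idI) (simp add: f_inv_into_f)
  then have "sorted_wrt clockwise ?ls"
    using set assms(2) by (subst sorted_clockwise_iff) (simp_all add: rev_map)
  with set have "\<exists>!ls. set ls = R \<and> sorted_wrt clockwise ls"
    using sorted_clockwise_unique assms(2) by (intro ex1I[of _ ?ls]) blast+
  from theI'[OF this] show "set (clockwise_list R) = R" "sorted_wrt clockwise (clockwise_list R)"
    unfolding clockwise_list_def by auto
qed

lemma distinct_clockwise_list:
  assumes "finite R" "R \<subseteq> rays"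
  shows "distinct (clockwise_list R)"
proof -
  have "sorted_wrt (<) (rev (map (ray_slope z0) (clockwise_list R)))"
    using clockwise_list[OF assms] assms(2) by (subst sorted_clockwise_iff[symmetric]) auto
  then have "distinct (rev (map (ray_slope z0) (clockwise_list R)))"
    using strict_sorted_iff by blast
  then show ?thesis by (simp add: distinct_map)
qed

text \<open>Filtering preserves the order, and the clockwise enumeration of a set is unique.
  Products over nested sets of rays thus differ only by omitted factors.\<close>

lemma clockwise_list_filter:
  assumes "finite R" "R \<subseteq> rays" "R' \<subseteq> R"
  shows "clockwise_list R' = filter (\<lambda>l. l \<in> R') (clockwise_list R)"
proof (rule sorted_clockwise_unique)
  have R': "finite R'" "R' \<subseteq> rays" using assms finite_subset by blast+
  show "set (clockwise_list R') = R'" "sorted_wrt clockwise (clockwise_list R')" "R' \<subseteq> rays"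
    using clockwise_list[OF R'] R' by auto
  show "set (filter (\<lambda>l. l \<in> R') (clockwise_list R)) = R'"
    using clockwise_list[OF assms(1,2)] assms(3) by auto
  show "sorted_wrt clockwise (filter (\<lambda>l. l \<in> R') (clockwise_list R))"
    using clockwise_list[OF assms(1,2)] by (intro sorted_wrt_filter)
qed

end

section \<open>Ordered products over sectors\<close>

lemma sector_mono:
  assumes "c \<le> d" and "0 < c"
  shows "sector z0 c \<subseteq> sector z0 d"
proof
  fix z assume z: "z \<in> sector z0 c"
  have "c * Re (z * cnj z0) \<le> d * Re (z * cnj z0)"
    using sector_Re_pos[OF z assms(2)] assms(1) by (intro mult_right_mono) auto
  then show "z \<in> sector z0 d" using z unfolding sector_def mem_Collect_eq by linarith
qed

lemma sum_list_split_member: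
  fixes xs :: "'g::ab_group_add list"
  assumes "\<beta> \<in> set xs" and "length xs \<ge> 2"
  obtains \<rho> where "sum_list xs = \<beta> + \<rho>" and "\<rho> \<in> additive_hull (set xs)"
proof (rule that[of "sum_list (remove1 \<beta> xs)"])
  show "sum_list xs = \<beta> + sum_list (remove1 \<beta> xs)"
    using sum_list_map_remove1[OF assms(1), of id] by simp
  have "length (remove1 \<beta> xs) > 0" using assms by (simp add: length_remove1)
  then show "sum_list (remove1 \<beta> xs) \<in> additive_hull (set xs)"
    using set_remove1_subset[of \<beta> xs] unfolding additive_hull_def by blast
qed

lemma add_closed_additive_vimage:
  assumes "Modules.additive f" and "\<And>z w. z \<in> V \<Longrightarrow> w \<in> V \<Longrightarrow> z + w \<in> V"
  shows "add_closed {\<alpha>. f \<alpha> \<in> V}"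
  using assms(2) by (simp add: add_closed_def additive.add[OF assms(1)])

text \<open>After rotation let r be the real part of w. Slope below 1/4 gives modulus at most 5r/4,
  so the perturbation is at most r/4. The new real part is at least 3r/4 and the new imaginary part
  is below r/2 in absolute value.\<close>

lemma sector_perturb:
  assumes "w \<in> sector z0 (1/4)" and "cmod (v - w) \<le> 1/5 * cmod w"
  shows "v \<in> sector z0 1"
proof -
  define r where "r = Re (w * cnj z0)"
  have r: "r > 0" "\<bar>Im (w * cnj z0)\<bar> < r / 4"
    using sector_Re_pos[OF assms(1)] assms(1) by (auto simp: r_def sector_def)
  have "cmod (w * cnj z0) \<le> \<bar>r\<bar> + \<bar>Im (w * cnj z0)\<bar>" unfolding r_def by (rule cmod_le)
  then have "cmod (w * cnj z0) \<le> 5/4 * r" using r by linarith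
  moreover have "cmod (v * cnj z0 - w * cnj z0) \<le> 1/5 * cmod (w * cnj z0)"
    using mult_right_mono[OF assms(2), of "cmod z0"] by (simp add: norm_mult left_diff_distrib[symmetric])
  ultimately have "cmod (v * cnj z0 - w * cnj z0) \<le> r / 4" by linarith
  then have "\<bar>Re (v * cnj z0) - r\<bar> \<le> r / 4" "\<bar>Im (v * cnj z0) - Im (w * cnj z0)\<bar> \<le> r / 4"
    using abs_Re_le_cmod[of "v * cnj z0 - w * cnj z0"] abs_Im_le_cmod[of "v * cnj z0 - w * cnj z0"]
    unfolding r_def minus_complex.sel by linarith+
  then have "\<bar>Im (v * cnj z0)\<bar> < 1 * Re (v * cnj z0)" using r by linarith
  then show ?thesis unfolding sector_def by blast
qed

text \<open>Two vectors in an open sector with a right angle have positive inner product.\<close>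

lemma norm_add_gt_in_sector:
  assumes "p \<in> sector z0 1" and "q \<in> sector z0 1"
  shows "cmod p < cmod (p + q)"
proof -
  define P R where "P = p * cnj z0" and "R = q * cnj z0"
  have *: "\<bar>Im P\<bar> < Re P" "\<bar>Im R\<bar> < Re R"
    using assms unfolding sector_def P_def R_def by simp_all
  then have "\<bar>Im P\<bar> * \<bar>Im R\<bar> < Re P * Re R" by (intro mult_strict_mono) auto
  then have "Re P * Re R + Im P * Im R > 0" by (simp add: abs_mult[symmetric])
  moreover have "(cmod (P + R))\<^sup>2 = (cmod P)\<^sup>2 + (cmod R)\<^sup>2 + 2 * (Re P * Re R + Im P * Im R)"
    unfolding cmod_power2 by (simp add: power2_eq_square algebra_simps)
  ultimately have "(cmod P)\<^sup>2 < (cmod (P + R))\<^sup>2" by (smt (verit) zero_le_power2)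
  then have "cmod P < cmod (P + R)" by (rule power_less_imp_less_base) simp
  then have "cmod p * cmod z0 < cmod (p + q) * cmod z0"
    by (simp add: P_def R_def norm_mult distrib_right[symmetric])
  then show ?thesis by (simp add: mult_less_cancel_right)
qed

text \<open>The combination of \<open>u\<close> and \<open>w\<close> cancelling their images lies in
  the kernel of \<open>F\<close>, where the form is at most 0. Expanding it leaves only the mixed
  term to account for the sign, so \<open>B u w\<close> is nonnegative.\<close>

lemma quadratic_form_ray_add:
  assumes "quadratic_form Q" and "linear F" and kernel: "\<And>v. F v = (0 :: complex) \<Longrightarrow> Q v \<le> 0"
    and "F u \<in> ray_through z" "F w \<in> ray_through z" "Q u \<ge> 0" "Q w \<ge> 0"
  shows "Q (u + w) \<ge> 0"
proof -
  obtain B where B: "bilinear B" "\<And>u v. B u v = B v u" "\<And>v. Q v = B v v"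
    using assms(1) unfolding quadratic_form_def by blast
  obtain s t where st: "s > 0" "t > 0" "F u = s *\<^sub>R z" "F w = t *\<^sub>R z"
    using assms(4,5) by (auto simp: ray_through_def)
  note bil = bilinear_ladd[OF B(1)] bilinear_radd[OF B(1)] bilinear_lsub[OF B(1)] bilinear_rsub[OF B(1)]
    bilinear_lmul[OF B(1)] bilinear_rmul[OF B(1)]
  have "F (t *\<^sub>R u - s *\<^sub>R w) = 0"
    using st by (simp add: linear_diff[OF assms(2)] linear_cmul[OF assms(2)])
  then have "Q (t *\<^sub>R u - s *\<^sub>R w) \<le> 0" by (rule kernel)
  also have "Q (t *\<^sub>R u - s *\<^sub>R w) = t * t * Q u + s * s * Q w - 2 * (s * t * B u w)"
    by (simp add: B(3) bil B(2)[of w u] algebra_simps)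
  finally have "s * t * B u w \<ge> 0"
    using mult_nonneg_nonneg[OF _ assms(6), of "t * t"] mult_nonneg_nonneg[OF _ assms(7), of "s * s"]
    by simp
  then have "B u w \<ge> 0" using mult_pos_pos[OF st(1,2)] by (simp add: zero_le_mult_iff)
  moreover have "Q (u + w) = Q u + Q w + 2 * B u w" by (simp add: B(3) bil B(2)[of w u])
  ultimately show ?thesis using assms(6,7) by simp
qed

section \<open>The limit of the ordered products over a sector\<close>

context graded_lie_algebra
begin

lemma supp_ray_part: "supp (ray_part Z a l) = {\<beta> \<in> supp a. Z \<beta> \<in> l}"
  by (auto simp: supp_def ray_part_def)

text \<open>In a fixed degree only finitely many support elements, hence finitely many rays, matter,
  so the finite products stabilise. The stable values form an element of the group and determine it,
  so the description in \<open>A_cone\<close> denotes.\<close>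

lemma A_cone_limit:
  assumes sd: "stability_data Z a" and "z0 \<noteq> 0" and "0 < c" and "c \<le> 1"
  shows "\<forall>\<^sub>F R in finite_subsets_at_top {l. is_ray l \<and> l \<subseteq> sector z0 c}.
    Log (ordered_product Z a R) \<gamma> = Log (A_cone Z a (sector z0 c)) \<gamma>"
proof -
  define V where "V = sector z0 c"
  define rays where "rays = {l. is_ray l \<and> l \<subseteq> V}"
  obtain \<epsilon> where Z: "Modules.additive Z" and a: "a \<in> ghat" and \<epsilon>: "\<epsilon> > 0"
    "\<And>\<beta>. \<beta> \<in> supp a \<Longrightarrow> \<epsilon> * norm (\<iota> \<beta>) \<le> cmod (Z \<beta>)"
    using sd unfolding stability_data_def by blast
  define S where "S = semigroup_S V Z \<epsilon>"
  have S: "add_closed S"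
    unfolding S_def semigroup_S_def additive_hull_def[symmetric] by (rule add_closed_hull)
  have supp_S: "\<beta> \<in> S" if "\<beta> \<in> supp a" "Z \<beta> \<in> V" for \<beta>
    unfolding S_def semigroup_S_def additive_hull_def[symmetric]
    by (rule additive_hull_base) (use that \<epsilon> in auto)
  have S_V: "Z \<alpha> \<in> V" if "\<alpha> \<in> S" for \<alpha>
  proof -
    have "S \<subseteq> {\<alpha>. Z \<alpha> \<in> V}"
      unfolding S_def semigroup_S_def additive_hull_def[symmetric]
      by (intro additive_hull_subset add_closed_additive_vimage Z) (auto simp: V_def sector_add)
    then show ?thesis using that by blast
  qed
  have ray_supp: "supp (ray_part Z a l) \<subseteq> S" if "l \<in> rays" for l
    using that supp_S by (auto simp: supp_ray_part rays_def)
  have list: "set (clockwise_list R) = R" if "finite R" "R \<subseteq> rays" for R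
    using clockwise_list(1)[OF assms(2,3)] that unfolding rays_def V_def by blast
  have prod_supp: "supp (Log (ordered_product Z a R)) \<subseteq> S" if "finite R" "R \<subseteq> rays" for R
    unfolding Log_ordered_product using list[OF that] that ray_supp by (intro product_log_supp S) auto
  have ex: "\<exists>k. \<forall>\<^sub>F R in finite_subsets_at_top rays. Log (ordered_product Z a R) \<gamma> = k" for \<gamma>
  proof -
    \<comment> \<open>Only \<gamma> itself and the degrees completed to \<gamma> by an element of
      \<open>S\<close> can influence degree \<gamma> of a product.\<close>
    define D where "D = {\<beta>. \<beta> = \<gamma> \<or> \<gamma> - \<beta> \<in> S}"
    have D: "divisor_closed S D"
      unfolding divisor_closed_def D_def
    proof (intro ballI impI)
      fix \<alpha> \<beta> assume "\<alpha> \<in> S" "\<beta> \<in> S" and *: "\<alpha> + \<beta> \<in> {\<beta>. \<beta> = \<gamma> \<or> \<gamma> - \<beta> \<in> S}"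
      then have "\<gamma> - (\<alpha> + \<beta>) + \<alpha> \<in> S" "\<gamma> - (\<alpha> + \<beta>) + \<beta> \<in> S" if "\<alpha> + \<beta> \<noteq> \<gamma>"
        using S that unfolding add_closed_def by blast+
      moreover have "\<gamma> - (\<alpha> + \<beta>) + \<alpha> = \<gamma> - \<beta>" "\<gamma> - (\<alpha> + \<beta>) + \<beta> = \<gamma> - \<alpha>" by simp_all
      ultimately show "\<alpha> \<in> {\<beta>. \<beta> = \<gamma> \<or> \<gamma> - \<beta> \<in> S} \<and> \<beta> \<in> {\<beta>. \<beta> = \<gamma> \<or> \<gamma> - \<beta> \<in> S}"
        using \<open>\<alpha> \<in> S\<close> \<open>\<beta> \<in> S\<close> by (cases "\<alpha> + \<beta> = \<gamma>") auto
    qed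
    define E where "E = {\<beta> \<in> supp a. Z \<beta> \<in> V \<and> \<beta> \<in> D}"
    \<comment> \<open>The complement of \<beta> in \<gamma> has its charge in the sector, so the
      projection of \<open>Z \<beta>\<close> onto the axis is at most that of
      \<open>Z \<gamma>\<close>. This bounds the modulus of \<open>Z \<beta>\<close>, and the
      support condition then bounds the norm.\<close>
    have "E \<subseteq> {\<beta>. norm (\<iota> \<beta>) \<le> 2 * Re (Z \<gamma> * cnj z0) / (\<epsilon> * cmod z0)}"
    proof
      fix \<beta> assume \<beta>: "\<beta> \<in> E"
      have "Re (Z \<beta> * cnj z0) \<le> Re (Z \<gamma> * cnj z0)"
      proof (cases "\<beta> = \<gamma>")
        case False
        then have "Z (\<gamma> - \<beta>) \<in> V" using \<beta> S_V by (auto simp: E_def D_def)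
        then have "Re (Z (\<gamma> - \<beta>) * cnj z0) > 0" using sector_Re_pos assms(3) unfolding V_def by blast
        then show ?thesis by (simp add: additive.diff[OF Z] algebra_simps)
      qed simp
      moreover have "cmod (Z \<beta>) * cmod z0 \<le> 2 * Re (Z \<beta> * cnj z0)"
        using \<beta> assms(3,4) by (intro sector_norm_bound) (auto simp: E_def V_def)
      moreover have "\<epsilon> * norm (\<iota> \<beta>) * cmod z0 \<le> cmod (Z \<beta>) * cmod z0"
        using \<beta> \<epsilon> by (intro mult_right_mono) (auto simp: E_def)
      ultimately have "norm (\<iota> \<beta>) * (\<epsilon> * cmod z0) \<le> 2 * Re (Z \<gamma> * cnj z0)"
        by (simp only: mult_ac)
      then have "norm (\<iota> \<beta>) \<le> 2 * Re (Z \<gamma> * cnj z0) / (\<epsilon> * cmod z0)"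
        using \<epsilon>(1) assms(2) by (simp add: pos_le_divide_eq del: times_complex.sel)
      then show "\<beta> \<in> {\<beta>. norm (\<iota> \<beta>) \<le> 2 * Re (Z \<gamma> * cnj z0) / (\<epsilon> * cmod z0)}" by blast
    qed
    then have "finite E" using finite_lattice_ball finite_subset by blast
    define R0 where "R0 = (\<lambda>\<beta>. ray_through (Z \<beta>)) ` E"
    have "is_ray (ray_through (Z \<beta>)) \<and> ray_through (Z \<beta>) \<subseteq> V" if "Z \<beta> \<in> V" for \<beta>
    proof -
      have "Z \<beta> \<noteq> 0" using that by (auto simp: V_def sector_def)
      then show ?thesis
        using that is_ray_ray_through ray_through_subset_sector unfolding V_def by blast
    qed
    then have R0: "finite R0" "R0 \<subseteq> rays"
      using \<open>finite E\<close> unfolding R0_def rays_def E_def by blast+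
    have "Log (ordered_product Z a R) \<gamma> = Log (ordered_product Z a R0) \<gamma>"
      if R: "finite R" "R0 \<subseteq> R" "R \<subseteq> rays" for R
    proof -
      have filter: "clockwise_list R0 = filter (\<lambda>l. l \<in> R0) (clockwise_list R)"
        using R by (intro clockwise_list_filter[OF assms(2,3)]) (auto simp: rays_def V_def)
      show ?thesis
        unfolding Log_ordered_product filter
      proof (rule product_log_filter[OF S D])
        show "\<gamma> \<in> D" by (simp add: D_def)
        show "supp (ray_part Z a l) \<subseteq> S" if "l \<in> set (clockwise_list R)" for l
          using that list[OF R(1,3)] R(3) ray_supp by blast
        fix l \<beta> assume l: "l \<in> set (clockwise_list R)" "l \<notin> R0" "\<beta> \<in> D"
        then have l': "is_ray l" "l \<subseteq> V" using list[OF R(1,3)] R(3) by (auto simp: rays_def)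
        show "ray_part Z a l \<beta> = 0"
        proof (rule ccontr)
          assume "ray_part Z a l \<beta> \<noteq> 0"
          then have "Z \<beta> \<in> l" "\<beta> \<in> supp a" by (auto simp: ray_part_def supp_def split: if_splits)
          then have "\<beta> \<in> E" "l = ray_through (Z \<beta>)"
            using l' l(3) is_ray_eq_ray_through by (auto simp: E_def)
          then show False using l(2) by (auto simp: R0_def)
        qed
      qed
    qed
    then show ?thesis using R0 unfolding eventually_finite_subsets_at_top by blast
  qed
  then obtain h where h: "\<And>\<gamma>. \<forall>\<^sub>F R in finite_subsets_at_top rays. Log (ordered_product Z a R) \<gamma> = h \<gamma>"
    by metis
  \<comment> \<open>Each component of \<open>h\<close> occurs in an actual finite product, from
    which \<open>h\<close> inherits its support and grading.\<close>
  have R: "\<exists>R. finite R \<and> R \<subseteq> rays \<and> h \<gamma> = Log (ordered_product Z a R) \<gamma>" for \<gamma>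
  proof -
    have "\<forall>\<^sub>F R in finite_subsets_at_top rays. finite R \<and> R \<subseteq> rays"
      unfolding eventually_finite_subsets_at_top by auto
    with h[of \<gamma>] have "\<forall>\<^sub>F R in finite_subsets_at_top rays.
        finite R \<and> R \<subseteq> rays \<and> h \<gamma> = Log (ordered_product Z a R) \<gamma>"
      by eventually_elim simp
    then show ?thesis by (rule eventually_happens'[OF finite_subsets_at_top_neq_bot])
  qed
  have supp_h: "supp h \<subseteq> S"
  proof
    fix \<gamma> assume "\<gamma> \<in> supp h"
    moreover obtain R where "finite R" "R \<subseteq> rays" "h \<gamma> = Log (ordered_product Z a R) \<gamma>"
      using R by blast
    ultimately show "\<gamma> \<in> S" using prod_supp[of R] by (auto simp: supp_def)
  qed
  have "a \<gamma> \<in> G \<gamma>" for \<gamma> using a unfolding ghat_def by blast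
  then have "h \<gamma> \<in> G \<gamma>" for \<gamma>
    using R[of \<gamma>] product_log_graded unfolding Log_ordered_product by metis
  moreover have "h 0 = 0"
  proof -
    have "Z 0 \<notin> V" by (simp add: additive.zero[OF Z] V_def sector_def)
    then show ?thesis using S_V supp_h by (auto simp: supp_def)
  qed
  ultimately have "h \<in> ghat_cone V Z"
    using supp_h \<epsilon>(1) unfolding ghat_cone_def ghat_eps_def ghat_def S_def by blast
  then have "\<exists>!g. g \<in> Ghat_cone V Z \<and>
    (\<forall>\<gamma>. \<forall>\<^sub>F R in finite_subsets_at_top rays. Log (ordered_product Z a R) \<gamma> = Log g \<gamma>)"
  proof (intro ex1I[of _ "Exp h"] conjI allI)
    fix g assume g: "g \<in> Ghat_cone V Z \<and>
      (\<forall>\<gamma>. \<forall>\<^sub>F R in finite_subsets_at_top rays. Log (ordered_product Z a R) \<gamma> = Log g \<gamma>)"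
    have "Log g \<gamma> = h \<gamma>" for \<gamma>
    proof -
      have "\<forall>\<^sub>F R in finite_subsets_at_top rays. Log g \<gamma> = h \<gamma>"
        using h[of \<gamma>] g[THEN conjunct2, rule_format, of \<gamma>] by eventually_elim simp
      then show ?thesis by simp
    qed
    then have "Log g = h" by blast
    then show "g = Exp h" by (cases g) simp
  qed (use h in \<open>auto simp: Ghat_cone_def\<close>)
  from theI'[OF this] show ?thesis unfolding A_cone_def rays_def V_def by blast
qed

text \<open>A commutator term in degree \<gamma> would exhibit \<gamma> as a sum of at least two
  support elements over the sector. Only linear terms remain, and exactly one ray contains
  \<open>Z \<gamma>\<close>.\<close>

lemma Log_A_cone_indecomposable:
  assumes sd: "stability_data Z a" and "z0 \<noteq> 0" and "0 < c" and "c \<le> 1" and \<gamma>: "Z \<gamma> \<in> sector z0 c"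
    and indec: "\<And>xs. length xs \<ge> 2 \<Longrightarrow> set xs \<subseteq> {\<beta> \<in> supp a. Z \<beta> \<in> sector z0 c} \<Longrightarrow> sum_list xs \<noteq> \<gamma>"
  shows "Log (A_cone Z a (sector z0 c)) \<gamma> = a \<gamma>"
proof -
  define rays where "rays = {l. is_ray l \<and> l \<subseteq> sector z0 c}"
  define S where "S = additive_hull {\<beta> \<in> supp a. Z \<beta> \<in> sector z0 c}"
  have "Z \<gamma> \<noteq> 0" using \<gamma> by (auto simp: sector_def)
  then have l: "ray_through (Z \<gamma>) \<in> rays"
    using \<gamma> by (auto simp: rays_def is_ray_ray_through dest: ray_through_subset_sector)
  have "\<forall>\<^sub>F R in finite_subsets_at_top rays. {ray_through (Z \<gamma>)} \<subseteq> R \<and> finite R \<and> R \<subseteq> rays"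
    using l unfolding eventually_finite_subsets_at_top by (intro exI[of _ "{ray_through (Z \<gamma>)}"]) auto
  then have "\<forall>\<^sub>F R in finite_subsets_at_top rays. ray_through (Z \<gamma>) \<in> R \<and> finite R \<and> R \<subseteq> rays \<and>
      Log (ordered_product Z a R) \<gamma> = Log (A_cone Z a (sector z0 c)) \<gamma>"
    using A_cone_limit[OF assms(1-4), of \<gamma>, folded rays_def] by eventually_elim auto
  \<comment> \<open>A single finite set \<open>R\<close> is fixed that contains the ray of
    \<open>Z \<gamma>\<close> and for which degree \<gamma> has reached its limit.\<close>
  from eventually_happens'[OF finite_subsets_at_top_neq_bot this]
  obtain R where R: "ray_through (Z \<gamma>) \<in> R" "finite R" "R \<subseteq> rays"
    "Log (ordered_product Z a R) \<gamma> = Log (A_cone Z a (sector z0 c)) \<gamma>" by blast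
  have set: "set (clockwise_list R) = R" and dist: "distinct (clockwise_list R)"
    using clockwise_list(1)[OF assms(2,3) R(2) R(3)[unfolded rays_def]]
      distinct_clockwise_list[OF assms(2,3) R(2) R(3)[unfolded rays_def]] .
  have "product_log Z a (clockwise_list R) \<gamma> = (\<Sum>l\<leftarrow>clockwise_list R. ray_part Z a l \<gamma>)"
  proof (rule product_log_indecomposable)
    show "add_closed S" unfolding S_def by (rule add_closed_hull)
    show "supp (ray_part Z a l) \<subseteq> S" if "l \<in> set (clockwise_list R)" for l
      using that R(3) unfolding set S_def supp_ray_part rays_def by (auto intro!: additive_hull_base)
    show "\<gamma> - \<alpha> \<notin> S" if "\<alpha> \<in> S" for \<alpha>
    proof
      assume "\<gamma> - \<alpha> \<in> S"
      with that obtain xs where "length xs \<ge> 2" "set xs \<subseteq> {\<beta> \<in> supp a. Z \<beta> \<in> sector z0 c}"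
        "sum_list xs = \<alpha> + (\<gamma> - \<alpha>)"
        unfolding S_def by (rule additive_hull_add_decomposition)
      then show False using indec by simp
    qed
  qed
  also have "\<dots> = (\<Sum>l\<in>R. ray_part Z a l \<gamma>)" using sum_list_distinct_conv_sum_set[OF dist] set by simp
  also have "\<dots> = (\<Sum>l\<in>R. if l = ray_through (Z \<gamma>) then a \<gamma> else 0)"
    using R(3) mem_ray_iff by (intro sum.cong) (auto simp: ray_part_def rays_def)
  also have "\<dots> = a \<gamma>" using R(1,2) by simp
  finally show ?thesis using R(4) by (simp add: Log_ordered_product)
qed

end

section \<open>Variation of the components in a family\<close>

lemma pathin_preimage_open:
  assumes "pathin M g" and "J \<subseteq> {0..1}" and "openin M W"
  shows "openin (top_of_set J) {t \<in> J. g t \<in> W}"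
proof -
  have "continuous_map (top_of_set J) M g"
    using assms(1,2) unfolding pathin_def by (rule continuous_map_from_subtopology_mono)
  from openin_continuous_map_preimage[OF this assms(3)] show ?thesis by simp
qed

text \<open>Below the minimum of finitely many positive bounds there is still an uncountable
  interval, which a countable set cannot exhaust. It supplies the width of a thin sector.\<close>

lemma small_positive_avoiding:
  fixes d :: real
  assumes "finite T" and "countable N" and "d > 0"
  shows "\<exists>c>0. c \<le> d \<and> c \<notin> N \<and> (\<forall>t\<in>T. t > 0 \<longrightarrow> c < t)"
proof -
  define c0 where "c0 = Min (insert d {t \<in> T. t > 0})"
  have fin: "finite (insert d {t \<in> T. t > 0})" using assms(1) by simp
  have "c0 > 0" unfolding c0_def using fin assms(3) by (subst Min_gr_iff) auto
  then have "uncountable ({0<..<c0} - N)"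
    using assms(2) by (simp add: uncountable_minus_countable uncountable_open_interval)
  then obtain c where c: "c \<in> {0<..<c0}" "c \<notin> N" by (metis DiffE countable_empty ex_in_conv)
  have "c0 \<le> d" "\<And>t. t \<in> T \<Longrightarrow> t > 0 \<Longrightarrow> c0 \<le> t"
    unfolding c0_def using fin by (auto intro!: Min_le)
  then show ?thesis using c by (intro exI[of _ c]) force
qed

section \<open>Local behaviour of a single component\<close>

context graded_lie_algebra
begin

context
  fixes M :: "'m topology" and Z :: "'m \<Rightarrow> 'g \<Rightarrow> complex" and a :: "'m \<Rightarrow> 'g \<Rightarrow> 'a"
  assumes family: "continuous_stability_family M Z a"
begin

lemma stability_at: "x \<in> topspace M \<Longrightarrow> stability_data (Z x) (a x)"
  using family unfolding continuous_stability_family_def by blast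

lemma additive_at: "x \<in> topspace M \<Longrightarrow> Modules.additive (Z x)"
  using stability_at unfolding stability_data_def by blast

lemma supp_nonzero: "x \<in> topspace M \<Longrightarrow> \<beta> \<in> supp (a x) \<Longrightarrow> \<beta> \<noteq> 0"
  using stability_at unfolding stability_data_def ghat_def supp_def by blast

lemma central_charge_preimage_open:
  assumes "open S"
  shows "openin M {y \<in> topspace M. Z y \<beta> \<in> S}"
proof -
  have "continuous_map M (product_topology (\<lambda>_. euclidean) UNIV) Z"
    using family unfolding continuous_stability_family_def continuous_map_in_subtopology
      euclidean_product_topology by blast
  then have "continuous_map M euclidean (\<lambda>y. Z y \<beta>)" by (simp add: continuous_map_componentwise_UNIV)
  then show ?thesis using assms by (auto intro: openin_continuous_map_preimage)
qed

text \<open>If the charge of a nonzero \<beta> vanishes at \<open>x\<close>, it stays too small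
  nearby for the support inequality. If it is nonzero and off the ray, it lies outside the closed
  sector because \<open>c\<close> is below its slope, and stays outside nearby.\<close>

lemma exclude_off_ray:
  assumes x: "x \<in> topspace M" and z0: "z0 \<noteq> 0" and \<epsilon>: "\<epsilon> > 0" and c: "c > 0"
    and off: "Z x \<beta> \<notin> ray_through z0" and slope: "slope z0 (Z x \<beta>) \<noteq> 0 \<Longrightarrow> c < \<bar>slope z0 (Z x \<beta>)\<bar>"
  obtains N where "openin M N" "x \<in> N"
    "\<And>y. y \<in> N \<Longrightarrow> Z y \<beta> \<in> sector z0 c \<Longrightarrow> \<epsilon> * norm (\<iota> \<beta>) \<le> cmod (Z y \<beta>) \<Longrightarrow> False"
proof (cases "\<beta> = 0")
  case True
  have "Z y 0 \<notin> sector z0 c" if "y \<in> topspace M" for y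
    using additive.zero[OF additive_at[OF that]] by (simp add: sector_def)
  then show ?thesis using that[of "topspace M"] x True by blast
next
  case False
  then have pos: "\<epsilon> * norm (\<iota> \<beta>) > 0" using \<epsilon> \<iota>_eq_0_iff by simp
  show ?thesis
  proof (cases "Z x \<beta> = 0")
    case True
    show ?thesis
    proof (rule that)
      show "openin M {y \<in> topspace M. Z y \<beta> \<in> ball 0 (\<epsilon> * norm (\<iota> \<beta>))}"
        by (rule central_charge_preimage_open) simp
    qed (use x pos True in auto)
  next
    case False
    define u where "u = Z x \<beta> * cnj z0"
    have u: "u \<noteq> 0" using False z0 by (simp add: u_def)
    have "\<not> \<bar>Im u\<bar> \<le> c * Re u"
    proof
      assume le: "\<bar>Im u\<bar> \<le> c * Re u"
      then have "c * Re u \<ge> 0" by linarith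
      then have "Re u \<ge> 0" using c by (simp add: zero_le_mult_iff)
      moreover have "Re u \<noteq> 0" using le u by (auto simp: complex_eq_iff)
      ultimately have Re: "Re u > 0" by simp
      then have "\<bar>Im u / Re u\<bar> \<le> c" using le by (simp add: abs_divide pos_divide_le_eq)
      then have "slope z0 (Z x \<beta>) = 0" using slope unfolding slope_def u_def by linarith
      then have "Im u = 0" using Re unfolding slope_def u_def[symmetric] by simp
      then have "u = of_real (Re u)" by (simp add: complex_eq_iff)
      \<comment> \<open>Undoing the rotation shows that \<open>Z x \<beta>\<close> is a positive
        multiple of \<open>z0\<close>, against \<open>off\<close>.\<close>
      then have "Z x \<beta> * (cnj z0 * z0) = (Re u) *\<^sub>R z0"
        unfolding u_def by (metis mult.assoc scaleR_conv_of_real)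
      also have "cnj z0 * z0 = of_real ((cmod z0)\<^sup>2)" by (simp only: complex_norm_square mult.commute)
      finally have "(cmod z0)\<^sup>2 *\<^sub>R Z x \<beta> = Re u *\<^sub>R z0" by (simp add: scaleR_conv_of_real mult.commute)
      then have "Z x \<beta> = (Re u / (cmod z0)\<^sup>2) *\<^sub>R z0"
        using z0 by (metis divide_inverse_commute norm_eq_zero scaleR_scaleR scaleR_one left_inverse zero_eq_power2)
      moreover have "Re u / (cmod z0)\<^sup>2 > 0" using Re z0 by simp
      ultimately show False using off unfolding ray_through_def by blast
    qed
    then have notin: "Z x \<beta> \<notin> closure (sector z0 c)"
      using closure_sector_subset[of z0 c] unfolding u_def by blast
    show ?thesis
    proof (rule that)
      show "openin M {y \<in> topspace M. Z y \<beta> \<in> - closure (sector z0 c)}"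
        by (rule central_charge_preimage_open) (simp add: open_Compl)
    qed (use x notin closure_subset in auto)
  qed
qed

text \<open>The local constancy axiom is applied to a thin sector around
  \<open>Z x \<gamma>\<close>. A decomposition of \<gamma> over it uses only elements of a finite
  set \<open>F\<close>, and those off the ray at \<open>x\<close> are excluded nearby.\<close>

lemma locally_constant_or_decomposition:
  assumes U: "openin M U" "x \<in> U" and \<epsilon>: "\<epsilon> > 0"
    and supp_U: "\<And>y \<beta>. y \<in> U \<Longrightarrow> \<beta> \<in> supp (a y) \<Longrightarrow> \<epsilon> * norm (\<iota> \<beta>) \<le> cmod (Z y \<beta>)"
    and \<gamma>: "\<gamma> \<noteq> 0"
  obtains W k where "openin M W" "x \<in> W"
    "\<And>y. y \<in> W \<Longrightarrow> a y \<gamma> = k \<or>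
      (\<exists>xs. length xs \<ge> 2 \<and> sum_list xs = \<gamma> \<and> (\<forall>\<beta>\<in>set xs. \<beta> \<in> supp (a y) \<and>
        Z x \<beta> \<in> ray_through (Z x \<gamma>) \<and> Z y \<beta> \<in> sector (Z x \<gamma>) (1/4)))"
proof (cases "Z x \<gamma> = 0")
  case True
  have x: "x \<in> topspace M" using U openin_subset by blast
  have pos: "\<epsilon> * norm (\<iota> \<gamma>) > 0" using \<epsilon> \<gamma> \<iota>_eq_0_iff by simp
  let ?W = "U \<inter> {y \<in> topspace M. Z y \<gamma> \<in> ball 0 (\<epsilon> * norm (\<iota> \<gamma>))}"
  show ?thesis
  proof (rule that[of ?W 0])
    show "openin M ?W" by (intro openin_Int U(1) central_charge_preimage_open) simp
    show "x \<in> ?W" using True pos x U by simp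
    fix y assume y: "y \<in> ?W"
    \<comment> \<open>There is no ray of \<open>Z x \<gamma>\<close> here; instead the support
      condition is violated by \<gamma> near \<open>x\<close>, so the constant is 0.\<close>
    have "\<gamma> \<notin> supp (a y)" using supp_U[of y \<gamma>] y by auto
    then show "a y \<gamma> = 0 \<or> (\<exists>xs. length xs \<ge> 2 \<and> sum_list xs = \<gamma> \<and> (\<forall>\<beta>\<in>set xs. \<beta> \<in> supp (a y) \<and>
        Z x \<beta> \<in> ray_through (Z x \<gamma>) \<and> Z y \<beta> \<in> sector (Z x \<gamma>) (1/4)))"
      by (simp add: supp_def)
  qed
next
  case False
  define z0 where "z0 = Z x \<gamma>"
  have z0: "z0 \<noteq> 0" using False by (simp add: z0_def)
  have x: "x \<in> topspace M" using U openin_subset by blast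
  \<comment> \<open>The factor 4 is 2 from \<open>cmod (Z y \<gamma>) < 2 * cmod z0\<close> times 2
    from \<open>sector_norm_bound\<close>.\<close>
  define F where "F = {\<beta>. norm (\<iota> \<beta>) \<le> 4 * cmod z0 / \<epsilon>}"
  have F: "finite F" unfolding F_def by (rule finite_lattice_ball)
  have "finite ((\<lambda>\<beta>. \<bar>slope z0 (Z x \<beta>)\<bar>) ` F)" using F by simp
  moreover have "countable (range (\<lambda>\<beta>. \<bar>slope z0 (Z x \<beta>)\<bar>))" using countable_lattice by simp
  \<comment> \<open>Avoiding all slopes keeps the support off the boundary of the sector; lying
    below the positive ones on \<open>F\<close> separates its off-ray elements; the bound 1/4
    prepares for \<open>sector_perturb\<close>.\<close>
  ultimately obtain c where c: "0 < c" "c \<le> 1/4" "c \<notin> range (\<lambda>\<beta>. \<bar>slope z0 (Z x \<beta>)\<bar>)"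
    "\<And>t. t \<in> (\<lambda>\<beta>. \<bar>slope z0 (Z x \<beta>)\<bar>) ` F \<Longrightarrow> t > 0 \<Longrightarrow> c < t"
    using small_positive_avoiding[of _ _ "1/4"] by (metis zero_less_divide_1_iff zero_less_numeral)
  define V where "V = sector z0 c"
  have V: "blunt_strict_cone V" unfolding V_def by (rule blunt_strict_cone_sector[OF z0 c(1)])
  have "Z x ` supp (a x) \<inter> frontier V = {}"
  proof (rule ccontr)
    assume "Z x ` supp (a x) \<inter> frontier V \<noteq> {}"
    then obtain \<beta> where \<beta>: "\<beta> \<in> supp (a x)" "Z x \<beta> \<in> frontier V" by blast
    define u where "u = Z x \<beta> * cnj z0"
    have u: "\<bar>Im u\<bar> = c * Re u" using \<beta>(2) frontier_sector_subset unfolding V_def u_def by blast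
    then have "c * Re u \<ge> 0" by (metis abs_ge_zero)
    then have "Re u \<ge> 0" using c(1) by (simp add: zero_le_mult_iff)
    have "\<epsilon> * norm (\<iota> \<beta>) > 0" using \<epsilon> \<iota>_eq_0_iff supp_nonzero[OF x \<beta>(1)] by simp
    then have "Z x \<beta> \<noteq> 0" using supp_U[OF U(2) \<beta>(1)] by auto
    then have "u \<noteq> 0" using z0 by (simp add: u_def)
    then have "Re u \<noteq> 0" using u by (auto simp: complex_eq_iff)
    then have "c = \<bar>slope z0 (Z x \<beta>)\<bar>"
      using u \<open>Re u \<ge> 0\<close> unfolding slope_def u_def[symmetric] by (simp add: abs_divide)
    then show False using c(3) by blast
  qed
  then obtain U1 where U1: "openin M U1" "x \<in> U1"
    "(\<lambda>y. Log (A_cone (Z y) (a y) V) \<gamma>) constant_on U1"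
    using family V x unfolding continuous_stability_family_def by blast
  then obtain k where k: "\<And>y. y \<in> U1 \<Longrightarrow> Log (A_cone (Z y) (a y) V) \<gamma> = k"
    unfolding constant_on_def by blast
  have exN: "\<exists>N. openin M N \<and> x \<in> N \<and>
      (\<forall>y\<in>N. \<not> (Z y \<beta> \<in> V \<and> \<epsilon> * norm (\<iota> \<beta>) \<le> cmod (Z y \<beta>)))"
    if "\<beta> \<in> {\<beta> \<in> F. Z x \<beta> \<notin> ray_through z0}" for \<beta>
  proof -
    have off: "Z x \<beta> \<notin> ray_through z0" using that by blast
    have "c < \<bar>slope z0 (Z x \<beta>)\<bar>" if "slope z0 (Z x \<beta>) \<noteq> 0"
      using that c(4)[of "\<bar>slope z0 (Z x \<beta>)\<bar>"] \<open>\<beta> \<in> _\<close> by auto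
    from exclude_off_ray[OF x z0 \<epsilon> c(1) off this] show ?thesis unfolding V_def by metis
  qed
  have "\<exists>N. \<forall>\<beta>\<in>{\<beta> \<in> F. Z x \<beta> \<notin> ray_through z0}. openin M (N \<beta>) \<and> x \<in> N \<beta> \<and>
      (\<forall>y\<in>N \<beta>. \<not> (Z y \<beta> \<in> V \<and> \<epsilon> * norm (\<iota> \<beta>) \<le> cmod (Z y \<beta>)))"
    by (intro bchoice ballI exN)
  then obtain N where N: "\<And>\<beta>. \<beta> \<in> {\<beta> \<in> F. Z x \<beta> \<notin> ray_through z0} \<Longrightarrow> openin M (N \<beta>) \<and> x \<in> N \<beta> \<and>
      (\<forall>y\<in>N \<beta>. \<not> (Z y \<beta> \<in> V \<and> \<epsilon> * norm (\<iota> \<beta>) \<le> cmod (Z y \<beta>)))"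
    by blast
  \<comment> \<open>The last factor \<open>topspace M\<close> keeps the intersection open when no
    element of \<open>F\<close> is off the ray.\<close>
  define W where "W = U \<inter> U1 \<inter> {y \<in> topspace M. Z y \<gamma> \<in> V \<inter> ball 0 (2 * cmod z0)} \<inter>
    ((\<Inter>\<beta>\<in>{\<beta> \<in> F. Z x \<beta> \<notin> ray_through z0}. N \<beta>) \<inter> topspace M)"
  show ?thesis
  proof (rule that)
    show "openin M W"
      unfolding W_def
      by (intro openin_Int openin_INT U(1) U1(1) central_charge_preimage_open)
        (use F N open_sector in \<open>auto simp: V_def\<close>)
    show "x \<in> W"
      using x U U1 N z0 sector_self[OF z0 c(1)] z0_def[symmetric] unfolding W_def V_def by simp
    fix y assume "y \<in> W"
    then have y: "y \<in> U" "y \<in> U1" "y \<in> topspace M" "Z y \<gamma> \<in> V" "cmod (Z y \<gamma>) < 2 * cmod z0"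
      "\<And>\<beta>. \<beta> \<in> F \<Longrightarrow> Z x \<beta> \<notin> ray_through z0 \<Longrightarrow> Z y \<beta> \<in> V \<Longrightarrow>
        \<epsilon> * norm (\<iota> \<beta>) \<le> cmod (Z y \<beta>) \<Longrightarrow> False"
      using N unfolding W_def by auto
    note Zy = additive_at[OF y(3)]
    show "a y \<gamma> = k \<or> (\<exists>xs. length xs \<ge> 2 \<and> sum_list xs = \<gamma> \<and> (\<forall>\<beta>\<in>set xs. \<beta> \<in> supp (a y) \<and>
        Z x \<beta> \<in> ray_through (Z x \<gamma>) \<and> Z y \<beta> \<in> sector (Z x \<gamma>) (1/4)))"
    proof (cases "\<exists>xs. length xs \<ge> 2 \<and> set xs \<subseteq> {\<beta> \<in> supp (a y). Z y \<beta> \<in> V} \<and> sum_list xs = \<gamma>")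
      case True
      then obtain xs where xs: "length xs \<ge> 2" "set xs \<subseteq> {\<beta> \<in> supp (a y). Z y \<beta> \<in> V}" "sum_list xs = \<gamma>"
        by blast
      have "Z x \<beta> \<in> ray_through z0 \<and> Z y \<beta> \<in> sector z0 (1/4)" if \<beta>: "\<beta> \<in> set xs" for \<beta>
      proof
        have \<beta>': "\<beta> \<in> supp (a y)" "Z y \<beta> \<in> V" using xs(2) \<beta> by auto
        then show "Z y \<beta> \<in> sector z0 (1/4)" using sector_mono[OF c(2,1)] unfolding V_def by blast
        \<comment> \<open>The remaining summands also have charge in the sector, so the projection
          of \<open>Z y \<beta>\<close> onto the axis is at most that of
          \<open>Z y \<gamma>\<close>. This places \<beta> in \<open>F\<close>.\<close>
        obtain \<rho> where \<rho>: "\<gamma> = \<beta> + \<rho>" "\<rho> \<in> additive_hull (set xs)"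
          using sum_list_split_member[OF \<beta> xs(1)] xs(3) by metis
        have "additive_hull (set xs) \<subseteq> {\<alpha>. Z y \<alpha> \<in> V}"
          using xs(2) by (intro additive_hull_subset add_closed_additive_vimage Zy)
            (auto simp: V_def sector_add)
        then have "Re (Z y \<rho> * cnj z0) > 0" using \<rho>(2) sector_Re_pos c(1) unfolding V_def by blast
        then have "Re (Z y \<beta> * cnj z0) \<le> Re (Z y \<gamma> * cnj z0)"
          by (simp add: \<rho>(1) additive.add[OF Zy] algebra_simps)
        also have "\<dots> \<le> cmod (Z y \<gamma>) * cmod z0"
          using complex_Re_le_cmod[of "Z y \<gamma> * cnj z0"] by (simp add: norm_mult)
        also have "\<dots> \<le> 2 * cmod z0 * cmod z0" using y(5) by (intro mult_right_mono) auto
        finally have "cmod (Z y \<beta>) * cmod z0 \<le> 4 * cmod z0 * cmod z0"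
          using sector_norm_bound[of "Z y \<beta>" z0 c] \<beta>'(2) c(1,2) unfolding V_def by linarith
        then have "cmod (Z y \<beta>) \<le> 4 * cmod z0" using z0 by simp
        moreover have "\<epsilon> * norm (\<iota> \<beta>) \<le> cmod (Z y \<beta>)" using supp_U[OF y(1) \<beta>'(1)] .
        ultimately have "norm (\<iota> \<beta>) * \<epsilon> \<le> 4 * cmod z0" by (simp add: mult.commute)
        then have "\<beta> \<in> F" using \<epsilon> by (simp add: F_def pos_le_divide_eq)
        then show "Z x \<beta> \<in> ray_through z0" using y(6) \<beta>'(2) supp_U[OF y(1) \<beta>'(1)] by blast
      qed
      then show ?thesis using xs unfolding z0_def by blast
    next
      case False
      have "Log (A_cone (Z y) (a y) V) \<gamma> = a y \<gamma>"
        unfolding V_def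
        by (rule Log_A_cone_indecomposable[OF stability_at[OF y(3)] z0 c(1)])
          (use c(2) y(4) False in \<open>auto simp: V_def\<close>)
      then show ?thesis using k[OF y(2)] by simp
    qed
  qed
qed

text \<open>Pointwise continuity on the finite set from \<open>additive_bound\<close> controls all
  \<beta> at once, relative to the norm.\<close>

lemma central_charge_uniform_neighbourhood:
  assumes "x \<in> topspace M" and "\<eta> > 0"
  obtains W where "openin M W" "x \<in> W" "\<And>y \<beta>. y \<in> W \<Longrightarrow> cmod (Z y \<beta> - Z x \<beta>) \<le> \<eta> * norm (\<iota> \<beta>)"
proof -
  obtain B C where B: "finite B" "C > 0"
    and bound: "\<And>f \<gamma>. Modules.additive f \<Longrightarrow>
      cmod (f \<gamma>) \<le> C * (\<Sum>b\<in>B. cmod (f b)) * norm (\<iota> \<gamma>)"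
    using additive_bound by blast
  \<comment> \<open>The summand 1 keeps the denominator positive when \<open>B\<close> is
    empty.\<close>
  define d where "d = \<eta> / (C * (real (card B) + 1))"
  have d: "d > 0" using assms(2) B(2) by (simp add: d_def add_pos_nonneg)
  let ?W = "(\<Inter>b\<in>B. {y \<in> topspace M. Z y b \<in> ball (Z x b) d}) \<inter> topspace M"
  show ?thesis
  proof (rule that[of ?W])
    show "openin M ?W" by (intro openin_INT B(1) central_charge_preimage_open) simp
    show "x \<in> ?W" using assms(1) d by simp
    fix y \<beta> assume y: "y \<in> ?W"
    then have "Modules.additive (\<lambda>\<beta>. Z y \<beta> - Z x \<beta>)"
      using additive_at[of y] additive_at[OF assms(1)] by (simp add: Modules.additive_def)
    from bound[OF this, of \<beta>]
    have "cmod (Z y \<beta> - Z x \<beta>) \<le> C * (\<Sum>b\<in>B. cmod (Z y b - Z x b)) * norm (\<iota> \<beta>)" .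
    also have "\<dots> \<le> C * (real (card B) * d) * norm (\<iota> \<beta>)"
      using y B(2) by (intro mult_right_mono mult_left_mono sum_bounded_above)
        (auto simp: dist_norm norm_minus_commute)
    also have "\<dots> \<le> \<eta> * norm (\<iota> \<beta>)"
    proof (rule mult_right_mono)
      have "C * (real (card B) * d) \<le> C * ((real (card B) + 1) * d)"
        using d B(2) by (intro mult_left_mono mult_right_mono) auto
      also have "\<dots> = \<eta>" using B(2) by (simp add: d_def add_nonneg_pos divide_simps)
      finally show "C * (real (card B) * d) \<le> \<eta>" .
    qed simp
    finally show "cmod (Z y \<beta> - Z x \<beta>) \<le> \<eta> * norm (\<iota> \<beta>)" .
  qed
qed

section \<open>Transport of the support condition along a path\<close>

text \<open>By \<open>quadratic_form_ray_add\<close> the lattice points over one ray with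
  nonnegative form are closed under addition, so a sum with negative form has a summand with
  negative form.\<close>

lemma decomposition_meets_negative:
  assumes Q: "quadratic_form Q" and x: "x \<in> topspace M"
    and kernel: "\<And>v. real_extension \<iota> (Z x) v = 0 \<Longrightarrow> Q v \<le> 0"
    and xs: "xs \<noteq> []" "\<And>\<beta>. \<beta> \<in> set xs \<Longrightarrow> Z x \<beta> \<in> ray_through z"
    and neg: "Q (\<iota> (sum_list xs)) < 0"
  shows "\<exists>\<beta>\<in>set xs. Q (\<iota> \<beta>) < 0"
proof (rule ccontr)
  assume "\<not> (\<exists>\<beta>\<in>set xs. Q (\<iota> \<beta>) < 0)"
  then have nonneg: "Q (\<iota> \<beta>) \<ge> 0" if "\<beta> \<in> set xs" for \<beta> using that by force
  note Zx = additive_at[OF x]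
  let ?C = "{\<beta>. Q (\<iota> \<beta>) \<ge> 0 \<and> Z x \<beta> \<in> ray_through z}"
  have "add_closed ?C"
    unfolding add_closed_def
  proof (intro ballI)
    fix \<alpha> \<beta> assume *: "\<alpha> \<in> ?C" "\<beta> \<in> ?C"
    have "Q (\<iota> \<alpha> + \<iota> \<beta>) \<ge> 0"
      using * by (intro quadratic_form_ray_add[OF Q real_extension_linear(1)[OF Zx] kernel])
        (auto simp: real_extension_linear(2)[OF Zx])
    moreover have "Z x \<alpha> + Z x \<beta> \<in> ray_through z"
    proof -
      obtain s t where "s > 0" "t > 0" "Z x \<alpha> = s *\<^sub>R z" "Z x \<beta> = t *\<^sub>R z"
        using * by (auto simp: ray_through_def)
      then have "Z x \<alpha> + Z x \<beta> = (s + t) *\<^sub>R z" "s + t > 0" by (simp_all add: scaleR_left_distrib)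
      then show ?thesis unfolding ray_through_def by blast
    qed
    ultimately show "\<alpha> + \<beta> \<in> ?C" by (simp add: add additive.add[OF Zx])
  qed
  moreover have "set xs \<subseteq> ?C" using nonneg xs(2) by blast
  ultimately have "additive_hull (set xs) \<subseteq> ?C" by (rule additive_hull_subset)
  moreover have "sum_list xs \<in> additive_hull (set xs)" unfolding additive_hull_def using xs(1) by blast
  ultimately show False using neg by auto
qed

text \<open>The neighbourhood must serve all pairs of parameters in both directions, as required for
  propagation over the connected interval.\<close>

lemma support_transport:
  assumes Q: "quadratic_form Q"
    and kernel: "\<And>x v. x \<in> topspace M \<Longrightarrow> real_extension \<iota> (Z x) v = 0 \<Longrightarrow> Q v \<le> 0"
    and g: "pathin M g" and t0: "t0 \<in> {0..1}"
  shows "\<exists>T. openin (top_of_set {0..1}) T \<and> t0 \<in> T \<and> (\<forall>s\<in>T. \<forall>t\<in>T.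
    supp (a (g s)) \<subseteq> {\<gamma>. Q (\<iota> \<gamma>) \<ge> 0} \<longrightarrow> supp (a (g t)) \<subseteq> {\<gamma>. Q (\<iota> \<gamma>) \<ge> 0})"
proof -
  have path: "g t \<in> topspace M" if "t \<in> {0..1}" for t
    using path_image_subset_topspace[OF g] that by blast
  define x where "x = g t0"
  have x: "x \<in> topspace M" using path t0 by (simp add: x_def)
  then obtain U \<epsilon> where U: "openin M U" "x \<in> U" "\<epsilon> > 0"
    "\<And>y. y \<in> U \<Longrightarrow> supp (a y) \<subseteq> {\<gamma>. cmod (Z y \<gamma>) \<ge> \<epsilon> * norm (\<iota> \<gamma>)}"
    using family unfolding continuous_stability_family_def by meson
  then have supp_U: "\<epsilon> * norm (\<iota> \<beta>) \<le> cmod (Z y \<beta>)" if "y \<in> U" "\<beta> \<in> supp (a y)" for y \<beta>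
    using that by blast
  obtain W where W: "openin M W" "x \<in> W"
    "\<And>y \<beta>. y \<in> W \<Longrightarrow> cmod (Z y \<beta> - Z x \<beta>) \<le> \<epsilon> / 5 * norm (\<iota> \<beta>)"
    using central_charge_uniform_neighbourhood[OF x, of "\<epsilon> / 5"] U(3) by auto
  have "openin (top_of_set {0..1}) {t \<in> {0..1}. g t \<in> U \<inter> W}"
    by (intro pathin_preimage_open[OF g] openin_Int U(1) W(1)) simp
  moreover have "t0 \<in> {t \<in> {0..1}. g t \<in> U \<inter> W}" using t0 U(2) W(2) by (simp add: x_def)
  \<comment> \<open>A ball is taken so that \<open>J\<close> is an interval: the induction on
    \<gamma> uses connectedness of \<open>J\<close>.\<close>
  ultimately obtain \<delta> where \<delta>: "\<delta> > 0" "ball t0 \<delta> \<inter> {0..1} \<subseteq> {t \<in> {0..1}. g t \<in> U \<inter> W}"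
    unfolding openin_contains_ball by blast
  define J where "J = ball t0 \<delta> \<inter> {0..1}"
  have "connected J" unfolding J_def by (intro convex_connected convex_Int) auto
  have J: "t \<in> {0..1}" "g t \<in> topspace M" "g t \<in> U" "g t \<in> W" if "t \<in> J" for t
    using that \<delta>(2) path unfolding J_def by blast+
  have close: "cmod (Z x \<beta> - Z (g t) \<beta>) \<le> 1/5 * cmod (Z (g t) \<beta>)"
    if "t \<in> J" "\<beta> \<in> supp (a (g t))" for t \<beta>
    using W(3)[OF J(4)[OF that(1)], of \<beta>] supp_U[OF J(3)[OF that(1)] that(2)]
    by (simp add: norm_minus_commute)
  have lower: "4/5 * (\<epsilon> * norm (\<iota> \<beta>)) \<le> cmod (Z x \<beta>)" if "t \<in> J" "\<beta> \<in> supp (a (g t))" for t \<beta>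
  proof -
    have "cmod (Z (g t) \<beta>) \<le> cmod (Z x \<beta>) + cmod (Z x \<beta> - Z (g t) \<beta>)"
      by (metis norm_minus_commute norm_triangle_sub add.commute)
    then show ?thesis using close[OF that] supp_U[OF J(3)[OF that(1)] that(2)] by linarith
  qed
  \<comment> \<open>This finite set depends on the reference point \<open>x\<close> but not on the
    parameter; its cardinality is the induction measure.\<close>
  define below where "below = (\<lambda>\<gamma>. {\<beta>. 4/5 * (\<epsilon> * norm (\<iota> \<beta>)) \<le> cmod (Z x \<beta>) \<and> cmod (Z x \<beta>) < cmod (Z x \<gamma>)})"
  have fin: "finite (below \<gamma>)" for \<gamma>
  proof (rule finite_subset[OF _ finite_lattice_ball])
    show "below \<gamma> \<subseteq> {\<beta>. norm (\<iota> \<beta>) \<le> cmod (Z x \<gamma>) / (4/5 * \<epsilon>)}"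
      using U(3) by (auto simp: below_def pos_le_divide_eq mult_ac)
  qed
  have transport: "supp (a (g t)) \<subseteq> {\<gamma>. Q (\<iota> \<gamma>) \<ge> 0}"
    if s: "s \<in> J" and t: "t \<in> J" and supp_s: "supp (a (g s)) \<subseteq> {\<gamma>. Q (\<iota> \<gamma>) \<ge> 0}" for s t
  proof -
    \<comment> \<open>The claim covers all parameters in \<open>J\<close> together, because a
      smaller summand must vanish at the very parameter where the decomposition occurs.\<close>
    have vanish: "a (g t) \<gamma> = 0" if "Q (\<iota> \<gamma>) < 0" "t \<in> J" for \<gamma> t
      using that
    proof (induction "card (below \<gamma>)" arbitrary: \<gamma> t rule: less_induct)
      case less
      have "\<gamma> \<noteq> 0"
        using less.prems(1) Q zero unfolding quadratic_form_def by (auto simp: bilinear_lzero)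
      have "\<exists>T. openin (top_of_set J) T \<and> r \<in> T \<and>
          (\<forall>u\<in>T. \<forall>v\<in>T. a (g u) \<gamma> = 0 \<longrightarrow> a (g v) \<gamma> = 0)" if r: "r \<in> J" for r
      proof -
        obtain N k where N: "openin M N" "g r \<in> N"
          and dec: "\<And>y. y \<in> N \<Longrightarrow> a y \<gamma> = k \<or>
            (\<exists>xs. length xs \<ge> 2 \<and> sum_list xs = \<gamma> \<and> (\<forall>\<beta>\<in>set xs. \<beta> \<in> supp (a y) \<and>
              Z (g r) \<beta> \<in> ray_through (Z (g r) \<gamma>) \<and> Z y \<beta> \<in> sector (Z (g r) \<gamma>) (1/4)))"
          using locally_constant_or_decomposition[OF U(1) J(3)[OF r] U(3) supp_U \<open>\<gamma> \<noteq> 0\<close>]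
          by metis
        have "a (g u) \<gamma> = k" if u: "u \<in> J" "g u \<in> N" for u
        proof (rule ccontr)
          assume "a (g u) \<gamma> \<noteq> k"
          then obtain xs where xs: "length xs \<ge> 2" "sum_list xs = \<gamma>"
            and xs': "\<And>\<beta>. \<beta> \<in> set xs \<Longrightarrow> \<beta> \<in> supp (a (g u)) \<and>
              Z (g r) \<beta> \<in> ray_through (Z (g r) \<gamma>) \<and> Z (g u) \<beta> \<in> sector (Z (g r) \<gamma>) (1/4)"
            using dec[OF u(2)] by blast
          have "xs \<noteq> []" using xs(1) by auto
          then obtain \<beta> where \<beta>: "\<beta> \<in> set xs" "Q (\<iota> \<beta>) < 0"
            using decomposition_meets_negative[OF Q J(2)[OF r] kernel[OF J(2)[OF r]]]
              xs' less.prems(1) xs(2) by metis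
          \<comment> \<open>The sector around the charge at \<open>r\<close> is widened so that the
            charges at \<open>x\<close> fit: there the modulus is compared.\<close>
          have in_sector: "Z x \<alpha> \<in> sector (Z (g r) \<gamma>) 1" if "\<alpha> \<in> set xs" for \<alpha>
            using sector_perturb close[OF u(1)] xs'[OF that] by blast
          obtain \<rho> where \<rho>: "\<gamma> = \<beta> + \<rho>" "\<rho> \<in> additive_hull (set xs)"
            using sum_list_split_member[OF \<beta>(1) xs(1)] xs(2) by metis
          have "additive_hull (set xs) \<subseteq> {\<alpha>. Z x \<alpha> \<in> sector (Z (g r) \<gamma>) 1}"
            using in_sector by (intro additive_hull_subset add_closed_additive_vimage
                additive_at[OF x]) (auto simp: sector_add)
          then have "cmod (Z x \<beta>) < cmod (Z x \<beta> + Z x \<rho>)"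
            using \<rho>(2) in_sector[OF \<beta>(1)] norm_add_gt_in_sector by blast
          then have "cmod (Z x \<beta>) < cmod (Z x \<gamma>)"
            using \<rho>(1) by (simp add: additive.add[OF additive_at[OF x]])
          moreover have "4/5 * (\<epsilon> * norm (\<iota> \<beta>)) \<le> cmod (Z x \<beta>)"
            using lower[OF u(1)] xs'[OF \<beta>(1)] by blast
          \<comment> \<open>Strictness comes from \<beta> itself, which lies in
            \<open>below \<gamma>\<close> but not in \<open>below \<beta>\<close>.\<close>
          ultimately have "below \<beta> \<subset> below \<gamma>" unfolding below_def by force
          then have "card (below \<beta>) < card (below \<gamma>)" using fin by (rule psubset_card_mono[rotated])
          then have "a (g u) \<beta> = 0" using less.hyps \<beta>(2) u(1) by blast
          then show False using xs'[OF \<beta>(1)] by (simp add: supp_def)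
        qed
        moreover have "openin (top_of_set J) {u \<in> J. g u \<in> N}"
          using J(1) by (intro pathin_preimage_open[OF g _ N(1)]) blast
        ultimately show ?thesis using r N(2) by (intro exI[of _ "{u \<in> J. g u \<in> N}"]) simp
      qed
      moreover have "a (g s) \<gamma> = 0" using supp_s less.prems(1) by (force simp: supp_def)
      ultimately show ?case
        using connected_induction_simple[OF \<open>connected J\<close> s less.prems(2), of "\<lambda>t. a (g t) \<gamma> = 0"]
        by blast
    qed
    show ?thesis
    proof (intro subsetI CollectI)
      fix \<gamma> assume "\<gamma> \<in> supp (a (g t))"
      then show "Q (\<iota> \<gamma>) \<ge> 0" using vanish[OF _ t, of \<gamma>] by (force simp: supp_def not_less)
    qed
  qed
  moreover have "openin (top_of_set {0..1}) J"
    unfolding J_def openin_open by (intro exI[of _ "ball t0 \<delta>"]) auto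
  moreover have "t0 \<in> J" using t0 \<delta>(1) by (simp add: J_def)
  ultimately show ?thesis by (intro exI[of _ J] conjI ballI impI)
qed

end

end

theorem theorem4p10:
  fixes \<iota> :: "'g::ab_group_add \<Rightarrow> 'v::real_normed_vector"
    and scale :: "'k::comm_ring_1 \<Rightarrow> 'a::ab_group_add \<Rightarrow> 'a"
    and \<phi> :: "rat \<Rightarrow> 'k"
    and br :: "'a \<Rightarrow> 'a \<Rightarrow> 'a"
    and G :: "'g \<Rightarrow> 'a set"
    and M :: "'m topology"
    and Z :: "'m \<Rightarrow> 'g \<Rightarrow> complex"
    and a :: "'m \<Rightarrow> 'g \<Rightarrow> 'a"
    and Q :: "'v \<Rightarrow> real"
  assumes "graded_lie_algebra \<iota> scale \<phi> br G"
    and "path_connected_space M"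
    and "graded_lie_algebra.continuous_stability_family \<iota> scale \<phi> br G M Z a"
    and "quadratic_form Q"
    and "\<And>x v. x \<in> topspace M \<Longrightarrow> real_extension \<iota> (Z x) v = 0 \<Longrightarrow> Q v \<le> 0"
    and "\<exists>x\<in>topspace M. supp (a x) \<subseteq> {\<gamma>. Q (\<iota> \<gamma>) \<ge> 0}"
  shows "\<forall>y\<in>topspace M. supp (a y) \<subseteq> {\<gamma>. Q (\<iota> \<gamma>) \<ge> 0}"
proof
  fix y assume y: "y \<in> topspace M"
  obtain x where x: "x \<in> topspace M" "supp (a x) \<subseteq> {\<gamma>. Q (\<iota> \<gamma>) \<ge> 0}" using assms(6) by blast
  obtain g where g: "pathin M g" "g 0 = x" "g 1 = y"
    using assms(2) x(1) y unfolding path_connected_space_def by blast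
  have "supp (a (g 1)) \<subseteq> {\<gamma>. Q (\<iota> \<gamma>) \<ge> 0}"
  \<comment> \<open>Connectedness of the unit interval carries the local implication from parameter
    0 to parameter 1.\<close>
  proof (rule connected_induction_simple[where S = "{0..1::real}" and a = 0
        and P = "\<lambda>t. supp (a (g t)) \<subseteq> {\<gamma>. Q (\<iota> \<gamma>) \<ge> 0}"])
    fix t :: real assume t: "t \<in> {0..1}"
    show "\<exists>T. openin (top_of_set {0..1}) T \<and> t \<in> T \<and> (\<forall>s\<in>T. \<forall>t\<in>T.
        supp (a (g s)) \<subseteq> {\<gamma>. Q (\<iota> \<gamma>) \<ge> 0} \<longrightarrow> supp (a (g t)) \<subseteq> {\<gamma>. Q (\<iota> \<gamma>) \<ge> 0})"
      by (rule graded_lie_algebra.support_transport[OF assms(1,3,4,5) g(1) t])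
  qed (use x(2) g(2) in auto)
  then show "supp (a y) \<subseteq> {\<gamma>. Q (\<iota> \<gamma>) \<ge> 0}" using g(3) by simp
qed

end
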